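(* Let $F_m$ be the free group with free basis $X=\{x_1,\dots,x_m\}$, let $x\in X$, let $\ell\ge1$, and let $f_H(n)$ be the cogrowth function, with respect to $X$, of the $\ell$-subnormal closure $H=\langle x\rangle_{\ell}^{F_m}$. (1) If $\ell\ge 2$ and $m\ge 3$, then $f_H(n)$ is maximal, i.e. $f_H(n)=\Theta((2m-1)^n)$. (2) If $\ell\ge 3$ and $m\ge 2$, then $f_H(n)$ is maximal, i.e. $f_H(n)=\Theta((2m-1)^n)$. (3) If $\ell=m=2$, then $f_H(n)=\Theta\left(\frac{3^n}{\sqrt n}\right)$.
   Context: For an element $x$ of a group $G$, the $\ell$-subnormal closure $\langle x\rangle_{\ell}^{G}$ is defined by induction on $\ell\ge1$: $\langle x\rangle_1^{G}$ is the normal closure of $x$ in $G$, and for $\ell\ge 2$, $\langle x\rangle_{\ell}^{G}$ is the normal closure of $x$ in the group $\langle x\rangle_{\ell-1}^{G}$. The cogrowth function of a subgroup $H\le F_m$ with respect to $X$ is $f_H(n)=\#\{Hg : g\in F_m,\ |g|\le n\}$, the number of distinct cosets of $H$ having a representative of length at most $n$, where $|g|$ is the length with respect to $X$. For nonnegative functions of $n$, $\phi(n)=\Theta(\psi(n))$ means that both $\phi(n)=O(\psi(n))$ and $\psi(n)=O(\phi(n))$ as $n\to\infty$. The cogrowth of $H\le F_m$ is called maximal if $f_H(n)=\Theta((2m-1)^n)$ (equivalently, $f_H$ is $\Theta$-equivalent to the growth function of $F_m$ itself when $m\ge 2$). *)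

theory Defs
  imports "HOL-Algebra.Generated_Groups" "HOL-Library.Landau_Symbols"
begin

section \<open>The free group on a set of generators\<close>

text \<open>The letter \<open>(a, True)\<close> stands for the generator \<open>a\<close>, and \<open>(a, False)\<close> for its inverse.
  The elements of the free group are the freely reduced words.\<close>

type_synonym 'a letter = "'a \<times> bool"

definition inv_letter :: "'a letter \<Rightarrow> 'a letter" where
  "inv_letter l = (fst l, \<not> snd l)"

definition reduced :: "'a letter list \<Rightarrow> bool" where
  "reduced w \<longleftrightarrow> successively (\<lambda>l l'. l' \<noteq> inv_letter l) w"

definition cons_reduce :: "'a letter \<Rightarrow> 'a letter list \<Rightarrow> 'a letter list" where
  "cons_reduce l w =
    (case w of [] \<Rightarrow> [l] | l' # w' \<Rightarrow> if l' = inv_letter l then w' else l # w)"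

text \<open>For reduced \<open>u\<close> and \<open>v\<close>, the product below is the free reduction of \<open>u @ v\<close>.\<close>

definition free_group :: "'a set \<Rightarrow> 'a letter list monoid" where
  "free_group X =
    \<lparr>carrier = {w. reduced w \<and> fst ` set w \<subseteq> X},
     mult = (\<lambda>u v. foldr cons_reduce u v),
     one = []\<rparr>"

definition free_gen :: "'a \<Rightarrow> 'a letter list" where
  "free_gen a = [(a, True)]"


section \<open>Subnormal closures\<close>

definition normal_closure :: "('a, 'b) monoid_scheme \<Rightarrow> 'a set \<Rightarrow> 'a set" where
  "normal_closure G S = \<Inter> {N. N \<lhd> G \<and> S \<subseteq> N}"

text \<open>The index \<open>0\<close> is only a convention that starts the recursion one step earlier: the case
  \<open>l = 1\<close> is the normal closure of \<open>x\<close> in \<open>G\<close> itself.\<close>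

primrec subnormal_closure :: "('a, 'b) monoid_scheme \<Rightarrow> nat \<Rightarrow> 'a \<Rightarrow> 'a set" where
  "subnormal_closure G 0 x = carrier G"
| "subnormal_closure G (Suc l) x =
     normal_closure (G\<lparr>carrier := subnormal_closure G l x\<rparr>) {x}"


section \<open>Word length and cogrowth\<close>

text \<open>The length of \<open>g\<close> is meaningful only if \<open>g\<close> lies in the subgroup generated by \<open>S\<close>.\<close>

definition word_length :: "('a, 'b) monoid_scheme \<Rightarrow> 'a set \<Rightarrow> 'a \<Rightarrow> nat" where
  "word_length G S g =
    (LEAST n. \<exists>ws. length ws = n \<and> set ws \<subseteq> S \<union> m_inv G ` S
       \<and> foldr (mult G) ws (one G) = g)"

definition cogrowth :: "('a, 'b) monoid_scheme \<Rightarrow> 'a set \<Rightarrow> 'a set \<Rightarrow> nat \<Rightarrow> nat" where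
  "cogrowth G S H n = card {H #>\<^bsub>G\<^esub> g | g. g \<in> carrier G \<and> word_length G S g \<le> n}"


section \<open>The free group is a group, and it is free on its generators\<close>

lemma inv_letter_simps [simp]:
  "inv_letter (inv_letter l) = l" "fst (inv_letter l) = fst l" "inv_letter l \<noteq> l"
  "(inv_letter l = inv_letter l') = (l = l')"
  by (auto simp: inv_letter_def prod_eq_iff)

lemma reduced_Nil [simp]: "reduced []"
  by (simp add: reduced_def)

lemma reduced_Cons:
  "reduced (l # w) \<longleftrightarrow> reduced w \<and> (w = [] \<or> hd w \<noteq> inv_letter l)"
  by (cases w) (auto simp: reduced_def)

lemma reduced_cons_reduce: "reduced w \<Longrightarrow> reduced (cons_reduce l w)"
  by (cases w) (auto simp: cons_reduce_def reduced_Cons)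

lemma set_cons_reduce: "set (cons_reduce l w) \<subseteq> insert l (set w)"
  by (cases w) (auto simp: cons_reduce_def)

lemma cons_reduce_reduced: "reduced (l # w) \<Longrightarrow> cons_reduce l w = l # w"
  by (cases w) (auto simp: cons_reduce_def reduced_Cons)

lemma cons_reduce_inverse: "reduced w \<Longrightarrow> cons_reduce l (cons_reduce (inv_letter l) w) = w"
  by (cases w; cases "tl w") (auto simp: cons_reduce_def reduced_Cons split: list.splits)

lemma reduced_foldr: "reduced v \<Longrightarrow> reduced (foldr cons_reduce u v)"
  by (induction u) (auto intro: reduced_cons_reduce)

lemma set_foldr_cons_reduce: "set (foldr cons_reduce u v) \<subseteq> set u \<union> set v"
proof (induction u)
  case (Cons l u)
  then show ?case using set_cons_reduce[of l "foldr cons_reduce u v"] by auto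
qed simp

lemma foldr_cons_reduce:
  assumes "reduced w"
  shows "foldr cons_reduce (cons_reduce l u) w = cons_reduce l (foldr cons_reduce u w)"
proof (cases u)
  case (Cons k u')
  then show ?thesis
    using cons_reduce_inverse[OF reduced_foldr[OF assms], of l u']
    by (auto simp: cons_reduce_def[of l "k # u'"])
qed (simp add: cons_reduce_def)

lemma foldr_cons_reduce_assoc:
  assumes "reduced w"
  shows "foldr cons_reduce (foldr cons_reduce u v) w
       = foldr cons_reduce u (foldr cons_reduce v w)"
  by (induction u) (auto simp: foldr_cons_reduce[OF assms])

lemma foldr_cons_reduce_Nil: "reduced u \<Longrightarrow> foldr cons_reduce u [] = u"
proof (induction u)
  case (Cons l u)
  then have "foldr cons_reduce u [] = u" by (simp add: reduced_Cons)
  then show ?case using Cons.prems by (simp add: cons_reduce_reduced)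
qed simp

lemma reduced_inverse:
  assumes "reduced w"
  shows "reduced (rev (map inv_letter w))"
proof -
  have "successively (\<lambda>l l'. l \<noteq> inv_letter l') w"
    using assms unfolding reduced_def by (rule successively_mono) auto
  then show ?thesis by (simp add: reduced_def successively_map)
qed

lemma foldr_cons_reduce_left_inverse:
  "foldr cons_reduce (rev (map inv_letter w)) w = []"
  by (induction w) (auto simp: cons_reduce_def)

lemma group_free_group: "group (free_group X)"
proof (rule groupI)
  fix u v assume "u \<in> carrier (free_group X)" "v \<in> carrier (free_group X)"
  then show "u \<otimes>\<^bsub>free_group X\<^esub> v \<in> carrier (free_group X)"
    using set_foldr_cons_reduce[of u v] by (fastforce simp: free_group_def reduced_foldr)
next
  fix w assume "w \<in> carrier (free_group X)"
  then have "rev (map inv_letter w) \<in> carrier (free_group X)"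
    by (auto simp: free_group_def reduced_inverse)
  moreover have "rev (map inv_letter w) \<otimes>\<^bsub>free_group X\<^esub> w = \<one>\<^bsub>free_group X\<^esub>"
    by (simp add: free_group_def foldr_cons_reduce_left_inverse)
  ultimately show "\<exists>v\<in>carrier (free_group X). v \<otimes>\<^bsub>free_group X\<^esub> w = \<one>\<^bsub>free_group X\<^esub>"
    by blast
qed (auto simp: free_group_def foldr_cons_reduce_assoc)

lemma free_gen_closed: "x \<in> X \<Longrightarrow> free_gen x \<in> carrier (free_group X)"
  by (simp add: free_group_def free_gen_def reduced_Cons)

lemma inv_free_gen:
  assumes "x \<in> X"
  shows "inv\<^bsub>free_group X\<^esub> free_gen x = [(x, False)]"
  using assms
  by (intro group.inv_equality[OF group_free_group] free_gen_closed)
     (simp_all add: free_group_def free_gen_def reduced_Cons cons_reduce_def inv_letter_def)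

lemma generate_free_gen: "generate (free_group X) (free_gen ` X) = carrier (free_group X)"
proof
  show "generate (free_group X) (free_gen ` X) \<subseteq> carrier (free_group X)"
    by (intro group.generate_incl[OF group_free_group]) (auto intro: free_gen_closed)
next
  have "w \<in> generate (free_group X) (free_gen ` X)"
    if "reduced w" "fst ` set w \<subseteq> X" for w
    using that
  proof (induction w)
    case Nil
    then show ?case using generate.one[of "free_group X"] by (simp add: free_group_def)
  next
    case (Cons l w)
    obtain a b where l: "l = (a, b)" by force
    have a: "a \<in> X" using Cons.prems l by simp
    have "[l] \<in> generate (free_group X) (free_gen ` X)"
      using generate.incl[of "free_gen a" "free_gen ` X" "free_group X"]
        generate.inv[of "free_gen a" "free_gen ` X" "free_group X"] a
      by (cases b) (auto simp: l inv_free_gen[unfolded free_gen_def] free_gen_def)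
    moreover have "w \<in> generate (free_group X) (free_gen ` X)"
      using Cons by (auto simp: reduced_Cons)
    moreover have "[l] \<otimes>\<^bsub>free_group X\<^esub> w = l # w"
      using Cons.prems by (simp add: free_group_def cons_reduce_reduced)
    ultimately show ?case using generate.eng by metis
  qed
  then show "carrier (free_group X) \<subseteq> generate (free_group X) (free_gen ` X)"
    by (auto simp: free_group_def)
qed

lemma free_group_extension:
  fixes X :: "'a set" and G (structure)
  assumes "group G" and f: "f \<in> X \<rightarrow> carrier G"
  shows "\<exists>h \<in> hom (free_group X) G. \<forall>x\<in>X. h (free_gen x) = f x"
proof -
  interpret group G by fact
  define e where "e = (\<lambda>l :: 'a letter. if snd l then f (fst l) else inv (f (fst l)))"
  define h where "h = (\<lambda>w. foldr (\<lambda>l r. e l \<otimes> r) w \<one>)"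
  have e: "e l \<in> carrier G" if "fst l \<in> X" for l
    using that f by (auto simp: e_def)
  have e_inv: "e l \<otimes> e (inv_letter l) = \<one>" if "fst l \<in> X" for l
    using that f by (auto simp: e_def inv_letter_def r_inv l_inv Pi_iff)
  have h: "h w \<in> carrier G" if "fst ` set w \<subseteq> X" for w
    using that by (induction w) (auto simp: h_def e)
  have h_cons: "h (cons_reduce l w) = e l \<otimes> h w" if "fst l \<in> X" "fst ` set w \<subseteq> X" for l w
  proof (cases "\<exists>w'. w = inv_letter l # w'")
    case True
    then obtain w' where w: "w = inv_letter l # w'" by blast
    have "e l \<otimes> (e (inv_letter l) \<otimes> h w') = h w'"
      using that e h e_inv by (simp add: w m_assoc[symmetric])
    then show ?thesis by (simp add: w cons_reduce_def h_def)
  next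
    case False
    then have "cons_reduce l w = l # w" by (cases w) (auto simp: cons_reduce_def)
    then show ?thesis by (simp add: h_def)
  qed
  have h_mult: "h (foldr cons_reduce u v) = h u \<otimes> h v"
    if "fst ` set u \<subseteq> X" "fst ` set v \<subseteq> X" for u v
    using that(1)
  proof (induction u)
    case Nil
    then show ?case using that(2) h by (simp add: h_def)
  next
    case (Cons l u)
    have "fst ` set (foldr cons_reduce u v) \<subseteq> X"
      using Cons.prems that(2) set_foldr_cons_reduce[of u v] by fastforce
    then have "h (foldr cons_reduce (l # u) v) = e l \<otimes> (h u \<otimes> h v)"
      using Cons by (simp add: h_cons)
    also have "\<dots> = h (l # u) \<otimes> h v"
      using Cons.prems that(2) h[of u] h[of v] e[of l] by (simp add: m_assoc h_def)
    finally show ?case .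
  qed
  have "h \<in> hom (free_group X) G"
    by (auto simp: hom_def free_group_def h_mult intro: h)
  moreover have "\<forall>x\<in>X. h (free_gen x) = f x"
    using f by (auto simp: h_def e_def free_gen_def Pi_iff)
  ultimately show ?thesis by blast
qed

end

theory Submission
  imports Defs
begin

text \<open>
  Write \<open>N\<^sub>k\<close> for the \<open>k\<close>-subnormal closure of \<open>x\<close>, with \<open>N\<^sub>0\<close> the whole group \<open>F\<close>. The Schreier graph
  of \<open>N\<^sub>l\<close> is a tree with loops attached: \<open>N\<^sub>l\<close> is generated by the conjugates \<open>p x p\<inverse>\<close> with
  \<open>p \<in> N\<^bsub>l-1\<^esub>\<close>, so the edge labelled \<open>x\<close> at the coset of \<open>p\<close> is a loop precisely when
  \<open>p \<in> N\<^bsub>l-1\<^esub>\<close>, and every cycle comes from these loops. Hence every coset has exactly one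
  reduced representative whose path from the root avoids the loops, that is, in which no prefix lying in
  \<open>N\<^bsub>l-1\<^esub>\<close> is followed by \<open>x\<close> or its inverse, and no representative is shorter. The cogrowth function
  counts such words (\<open>cogrowth_eq_card_tree_words\<close>), and a reduced word lies in \<open>N\<^sub>l\<close> iff its path in the
  graph of \<open>N\<^sub>l\<close> ends at the root (\<open>in_H_iff_retract\<close>).

  The counting is a survival problem for the non-backtracking random walk on \<open>F\<close>: a word dies when it
  reads \<open>x\<close> or its inverse after a prefix in \<open>N\<^bsub>l-1\<^esub>\<close>. The cogrowth is maximal iff the walk survives
  with positive probability. It does if its image in the Schreier graph of \<open>N\<^bsub>l-1\<^esub>\<close> can leave the
  root for ever, which a superharmonic function that is largest at the root shows. As the closures
  decrease with \<open>l\<close>, it is enough to treat the following graphs.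

  \<^item> In rank at least three, the graph of \<open>N\<^sub>1\<close> is the Cayley tree of a free group of rank at least two
    with a loop at every vertex. The function \<open>2\<^sup>-\<^sup>d\<close> of the distance \<open>d\<close> to the root is
    superharmonic away from it (\<open>maximal_growth_rank_ge_3\<close>).
  \<^item> In rank two, the graph of \<open>N\<^sub>1\<close> is a line with a loop at every vertex. In the graph of \<open>N\<^sub>2\<close> only the
    vertices over the root of this line carry loops. The other vertices have four neighbours, so the
    graph branches often enough for \<open>(3/4)\<^sup>d\<close> to be superharmonic away from the root, after a correction
    that depends on the last letter (\<open>maximal_growth_rank_two\<close>).
  \<^item> In rank two, the walk on the graph of \<open>N\<^sub>1\<close> itself is recurrent, and the probability of surviving
    \<open>n\<close> steps is of order \<open>1 / \<surd>n\<close> (\<open>sqrt_growth\<close>).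

  For the last estimate, a positive function \<open>h\<close> of the height and the last letter is harmonic and vanishes
  on dead words. The function \<open>1 - q\<^sup>h\<close> is then nearly harmonic, with a defect between constant multiples
  of \<open>(1 - q)\<^sup>2 q\<^sup>h\<close> (\<open>children_sum_excess\<close>). Adding up the defects over the first \<open>n\<close> steps, with
  \<open>1 - q\<close> a suitable multiple of \<open>1 / \<surd>n\<close>, gives both bounds (\<open>inverse_sqrt_bounds\<close>).
\<close>

section \<open>Cosets of a normal closure as the vertices of a tree\<close>

text \<open>
  Words are kept as stacks, with the most recent letter at the head, so that multiplying by a letter on
  the right is \<open>cons_reduce\<close>. A step reads one letter in the Schreier graph of the normal closure of
  \<open>x\<close> in \<open>L\<close>, whose vertices are represented by the tree words.
\<close>

definition tree_step :: "'a \<Rightarrow> 'a letter list set \<Rightarrow> 'a letter \<Rightarrow> 'a letter list \<Rightarrow> 'a letter list" where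
  "tree_step x L s t = (if fst s = x \<and> rev t \<in> L then t else cons_reduce s t)"

primrec tree_word :: "'a set \<Rightarrow> 'a \<Rightarrow> 'a letter list set \<Rightarrow> 'a letter list \<Rightarrow> bool" where
  "tree_word X x L [] \<longleftrightarrow> True"
| "tree_word X x L (s # t) \<longleftrightarrow>
     tree_word X x L t \<and> reduced (s # t) \<and> fst s \<in> X \<and> (fst s = x \<longrightarrow> rev t \<notin> L)"

text \<open>The vertex that the path labelled by a word reaches from the root.\<close>

definition retract :: "'a \<Rightarrow> 'a letter list set \<Rightarrow> 'a letter list \<Rightarrow> 'a letter list" where
  "retract x L r = foldr (tree_step x L) r []"

lemma retract_simps [simp]:
  "retract x L [] = []" "retract x L (s # r) = tree_step x L s (retract x L r)"
  by (simp_all add: retract_def)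

lemma reduced_rev [simp]: "reduced (rev t) \<longleftrightarrow> reduced t"
proof -
  have "reduced (rev t)" if "reduced t" for t :: "'a letter list"
  proof -
    have "successively (\<lambda>l l'. l \<noteq> inv_letter l') t"
      using that unfolding reduced_def by (rule successively_mono) auto
    then show ?thesis by (simp add: reduced_def)
  qed
  from this[of t] this[of "rev t"] show ?thesis by auto
qed

lemma foldr_cons_reduce_append: "reduced (u @ v) \<Longrightarrow> foldr cons_reduce u v = u @ v"
  by (induction u) (auto simp: reduced_Cons cons_reduce_reduced)

lemma mult_letter_eq_rev_cons_reduce:
  assumes "reduced t"
  shows "foldr cons_reduce (rev t) [s] = rev (cons_reduce s t)"
proof (cases "\<exists>t'. t = inv_letter s # t'")
  case True
  then obtain t' where t: "t = inv_letter s # t'" by blast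
  with assms have "reduced (rev t')" by (simp add: reduced_Cons)
  then show ?thesis by (simp add: t cons_reduce_def foldr_cons_reduce_Nil)
next
  case False
  then have c: "cons_reduce s t = s # t" by (cases t) (auto simp: cons_reduce_def)
  then have "reduced (rev (s # t))" using reduced_cons_reduce[OF assms, of s] by (simp del: rev.simps)
  then show ?thesis using c foldr_cons_reduce_append[of "rev t" "[s]"] by simp
qed

lemma length_cons_reduce: "length (cons_reduce s t) \<le> Suc (length t)"
  by (cases t) (auto simp: cons_reduce_def)

lemma word_length_free_group:
  assumes "g \<in> carrier (free_group X)"
  shows "word_length (free_group X) (free_gen ` X) g = length g"
proof -
  let ?F = "free_group X"
  have S: "free_gen ` X \<union> m_inv ?F ` free_gen ` X = {[s] | s. fst s \<in> X}" (is "?S = _")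
  proof -
    have "m_inv ?F ` free_gen ` X = (\<lambda>a. [(a, False)]) ` X"
      by (auto simp: inv_free_gen image_image)
    then show ?thesis by (auto simp: free_gen_def image_iff split: prod.splits)
  qed
  have long: "length (foldr (mult ?F) ws (one ?F)) \<le> length ws" if "set ws \<subseteq> ?S" for ws
    using that unfolding S
  proof (induction ws)
    case (Cons u ws)
    then obtain s where "u = [s]" by auto
    with Cons show ?case
      using length_cons_reduce[of s "foldr (mult ?F) ws (one ?F)"] by (auto simp: free_group_def)
  qed (simp add: free_group_def)
  have "foldr (mult ?F) (map (\<lambda>s. [s]) g) (one ?F) = foldr cons_reduce g []"
    by (induction g) (simp_all add: free_group_def)
  also have "\<dots> = g" using assms by (simp add: free_group_def foldr_cons_reduce_Nil)
  finally have g: "foldr (mult ?F) (map (\<lambda>s. [s]) g) (one ?F) = g" .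
  show ?thesis unfolding word_length_def
  proof (rule Least_equality)
    show "\<exists>ws. length ws = length g \<and> set ws \<subseteq> ?S \<and> foldr (mult ?F) ws (one ?F) = g"
      using g assms unfolding S
      by (intro exI[of _ "map (\<lambda>s. [s]) g"]) (auto simp: free_group_def)
  qed (use long in auto)
qed

lemma normal_closure_normal:
  assumes "group G" and "S \<subseteq> carrier G"
  shows "normal_closure G S \<lhd> G"
proof -
  interpret group G by fact
  have top: "carrier G \<in> {N. N \<lhd> G \<and> S \<subseteq> N}" (is "_ \<in> ?\<N>")
    using assms(2) by (auto intro!: normal_invI subgroup_self)
  have sub: "subgroup (\<Inter> ?\<N>) G"
    using top by (intro subgroups_Inter) (auto intro: normal_imp_subgroup)
  moreover have "a \<otimes>\<^bsub>G\<^esub> h \<otimes>\<^bsub>G\<^esub> inv\<^bsub>G\<^esub> a \<in> \<Inter> ?\<N>" if "a \<in> carrier G" "h \<in> \<Inter> ?\<N>" for a h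
    using that by (auto intro: normal.inv_op_closed2)
  ultimately show ?thesis unfolding normal_closure_def by (intro normal_invI) auto
qed

lemma normal_closure_superset: "S \<subseteq> normal_closure G S"
  by (auto simp: normal_closure_def)

lemma normal_closure_least: "N \<lhd> G \<Longrightarrow> S \<subseteq> N \<Longrightarrow> normal_closure G S \<subseteq> N"
  by (auto simp: normal_closure_def)

locale subgroup_with_generator =
  fixes X :: "'a set" and x :: 'a and L :: "'a letter list set"
  assumes x_in: "x \<in> X"
    and subgroup: "subgroup L (free_group X)"
    and gen_in: "free_gen x \<in> L"
begin

abbreviation "F \<equiv> free_group X"
abbreviation "act \<equiv> fold (tree_step x L)"

sublocale F: group F by (rule group_free_group)

lemma L_subset: "L \<subseteq> carrier F" using subgroup.subset[OF subgroup] .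

lemma tree_word_reduced: "tree_word X x L t \<Longrightarrow> reduced t"
  by (cases t) auto

lemma tree_word_in_carrier: "tree_word X x L t \<Longrightarrow> rev t \<in> carrier F"
proof -
  assume t: "tree_word X x L t"
  have "fst ` set t \<subseteq> X" using t by (induction t) auto
  then show ?thesis using tree_word_reduced[OF t] by (simp add: free_group_def)
qed

lemma letter_in: "fst s \<in> X \<Longrightarrow> [s] \<in> carrier F"
  by (simp add: free_group_def reduced_Cons)

lemma x_letter_in:
  assumes "fst s = x" shows "[s] \<in> L"
proof (cases "snd s")
  case True
  then have "[s] = free_gen x" using assms by (auto simp: free_gen_def prod_eq_iff)
  then show ?thesis using gen_in by simp
next
  case False
  then have "[s] = inv\<^bsub>F\<^esub> free_gen x" using assms x_in by (auto simp: inv_free_gen prod_eq_iff)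
  then show ?thesis using gen_in subgroup.m_inv_closed[OF subgroup] by simp
qed

lemma rev_cons_reduce:
  "reduced t \<Longrightarrow> rev (cons_reduce s t) = rev t \<otimes>\<^bsub>F\<^esub> [s]"
  by (simp add: free_group_def mult_letter_eq_rev_cons_reduce)

lemma tree_word_step:
  assumes "tree_word X x L t" and "fst s \<in> X"
  shows "tree_word X x L (tree_step x L s t)"
proof (cases t)
  case Nil
  then show ?thesis using assms by (auto simp: tree_step_def cons_reduce_def reduced_Cons)
next
  case (Cons s' t')
  then show ?thesis using assms by (auto simp: tree_step_def cons_reduce_def reduced_Cons)
qed

lemma mult_x_letter_in_iff:
  assumes "g \<in> carrier F" and "fst s = x"
  shows "g \<otimes>\<^bsub>F\<^esub> [s] \<in> L \<longleftrightarrow> g \<in> L"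
proof
  assume "g \<otimes>\<^bsub>F\<^esub> [s] \<in> L"
  then have "g \<otimes>\<^bsub>F\<^esub> [s] \<otimes>\<^bsub>F\<^esub> inv\<^bsub>F\<^esub> [s] \<in> L"
    using subgroup.m_closed[OF subgroup] subgroup.m_inv_closed[OF subgroup] x_letter_in[OF assms(2)]
    by blast
  moreover have "[s] \<in> carrier F" using assms x_in by (simp add: letter_in)
  ultimately show "g \<in> L" using assms(1) by (simp add: F.m_assoc)
qed (use assms in \<open>auto intro: subgroup.m_closed[OF subgroup] x_letter_in\<close>)

text \<open>
  Reading a letter is a permutation of the tree words because multiplication by \<open>x\<close> does not move an
  element into or out of \<open>L\<close>: an edge labelled \<open>x\<close> is a loop at both of its ends or at neither.
\<close>

lemma tree_step_inverse:
  assumes "tree_word X x L t" and "fst s \<in> X"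
  shows "tree_step x L (inv_letter s) (tree_step x L s t) = t"
proof (cases "fst s = x \<and> rev t \<in> L")
  case False
  have t: "reduced t" "rev t \<in> carrier F"
    using assms tree_word_reduced tree_word_in_carrier by auto
  then have "\<not> (fst s = x \<and> rev (cons_reduce s t) \<in> L)"
    using False mult_x_letter_in_iff by (auto simp: rev_cons_reduce)
  then show ?thesis
    using False cons_reduce_inverse[OF t(1), of "inv_letter s"] by (auto simp: tree_step_def)
qed (simp add: tree_step_def)

lemma tree_word_act:
  "tree_word X x L t \<Longrightarrow> fst ` set w \<subseteq> X \<Longrightarrow> tree_word X x L (act w t)"
  by (induction w arbitrary: t) (auto simp: tree_word_step)

lemma act_cons_reduce:
  assumes "tree_word X x L t" and "fst s \<in> X"
  shows "act (cons_reduce s w) t = act w (tree_step x L s t)"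
  by (cases w) (auto simp: cons_reduce_def tree_step_inverse[OF assms])

text \<open>
  Since inverse letters act inversely, free reduction does not change the effect of a word: the free
  group acts on the tree words from the right.
\<close>

lemma act_mult:
  assumes "u \<in> carrier F" and "v \<in> carrier F" and "tree_word X x L t"
  shows "act (u \<otimes>\<^bsub>F\<^esub> v) t = act v (act u t)"
proof -
  have "act (foldr cons_reduce u v) t = act v (act u t)" if "fst ` set u \<subseteq> X"
    using that assms(3)
    by (induction u arbitrary: t) (auto simp: act_cons_reduce tree_word_step)
  then show ?thesis using assms(1) by (simp add: free_group_def)
qed

end

locale closure_in_subgroup = subgroup_with_generator +
  fixes H :: "'a letter list set"
  assumes H_eq: "H = normal_closure (free_group X\<lparr>carrier := L\<rparr>) {free_gen x}"
begin

lemma group_L: "group (F\<lparr>carrier := L\<rparr>)"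
  using subgroup.subgroup_is_group[OF subgroup] F.group_axioms by auto

lemma inv_L: "p \<in> L \<Longrightarrow> inv\<^bsub>F\<lparr>carrier := L\<rparr>\<^esub> p = inv\<^bsub>F\<^esub> p"
  using F.m_inv_consistent[OF subgroup] by simp

lemma mult_L: "a \<otimes>\<^bsub>F\<lparr>carrier := L\<rparr>\<^esub> b = a \<otimes>\<^bsub>F\<^esub> b" by simp

lemma H_normal: "H \<lhd> F\<lparr>carrier := L\<rparr>"
  unfolding H_eq using gen_in by (intro normal_closure_normal group_L) auto

lemma H_subgroup: "subgroup H F"
  using F.incl_subgroup[OF subgroup] normal_imp_subgroup[OF H_normal] by blast

lemma H_subset_L: "H \<subseteq> L"
  using subgroup.subset[OF normal_imp_subgroup[OF H_normal]] by simp

lemma gen_in_H: "free_gen x \<in> H"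
  using normal_closure_superset[of "{free_gen x}"] unfolding H_eq by simp

lemma conj_x_letter_in_H:
  assumes "p \<in> L" and "fst s = x"
  shows "p \<otimes>\<^bsub>F\<^esub> [s] \<otimes>\<^bsub>F\<^esub> inv\<^bsub>F\<^esub> p \<in> H"
proof -
  have "[s] \<in> H"
    by (rule subgroup_with_generator.x_letter_in[OF subgroup_with_generator.intro assms(2)])
      (rule x_in H_subgroup gen_in_H)+
  moreover have "p \<in> carrier (F\<lparr>carrier := L\<rparr>)" using assms(1) by simp
  ultimately have "p \<otimes>\<^bsub>F\<lparr>carrier := L\<rparr>\<^esub> [s] \<otimes>\<^bsub>F\<lparr>carrier := L\<rparr>\<^esub> inv\<^bsub>F\<lparr>carrier := L\<rparr>\<^esub> p \<in> H"
    by (intro normal.inv_op_closed2[OF H_normal])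
  then show ?thesis unfolding inv_L[OF assms(1)] mult_L .
qed

text \<open>
  A loop does not leave the coset, since \<open>p x p\<inverse>\<close> lies in \<open>H\<close> for \<open>p\<close> in \<open>L\<close>.
\<close>

lemma coset_step:
  assumes t: "tree_word X x L t" and s: "fst s \<in> X"
  shows "H #>\<^bsub>F\<^esub> (rev t \<otimes>\<^bsub>F\<^esub> [s]) = H #>\<^bsub>F\<^esub> rev (tree_step x L s t)"
proof (cases "fst s = x \<and> rev t \<in> L")
  case True
  let ?c = "rev t \<otimes>\<^bsub>F\<^esub> [s] \<otimes>\<^bsub>F\<^esub> inv\<^bsub>F\<^esub> rev t"
  have c: "?c \<in> H" by (rule conj_x_letter_in_H) (use True in auto)
  have *: "rev t \<in> carrier F" "[s] \<in> carrier F"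
    using tree_word_in_carrier[OF t] letter_in[OF s] .
  have "?c \<otimes>\<^bsub>F\<^esub> rev t = rev t \<otimes>\<^bsub>F\<^esub> [s]" using * by (simp add: F.m_assoc)
  then have "H #>\<^bsub>F\<^esub> (rev t \<otimes>\<^bsub>F\<^esub> [s]) = (H #>\<^bsub>F\<^esub> ?c) #>\<^bsub>F\<^esub> rev t"
    using F.coset_mult_assoc[OF subgroup.subset[OF H_subgroup], of ?c "rev t"] * by simp
  also have "H #>\<^bsub>F\<^esub> ?c = H"
    by (rule F.coset_join2) (use c H_subgroup * in auto)
  finally show ?thesis using True by (simp add: tree_step_def)
qed (use rev_cons_reduce[OF tree_word_reduced[OF t]] in \<open>auto simp: tree_step_def\<close>)

lemma coset_act:
  assumes "tree_word X x L t" and "w \<in> carrier F"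
  shows "H #>\<^bsub>F\<^esub> (rev t \<otimes>\<^bsub>F\<^esub> w) = H #>\<^bsub>F\<^esub> rev (act w t)"
  using assms
proof (induction w arbitrary: t)
  case Nil
  then show ?case using F.r_one[OF tree_word_in_carrier[OF Nil(1)]] by (simp add: free_group_def)
next
  case (Cons s w)
  have s: "fst s \<in> X" and w: "w \<in> carrier F" and sw: "[s] \<otimes>\<^bsub>F\<^esub> w = s # w"
    using Cons.prems(2) by (auto simp: free_group_def reduced_Cons cons_reduce_reduced)
  let ?t = "tree_step x L s t"
  have t': "tree_word X x L ?t" using tree_word_step[OF Cons.prems(1) s] .
  have c: "rev t \<in> carrier F" "rev ?t \<in> carrier F" "[s] \<in> carrier F"
    using tree_word_in_carrier[OF Cons.prems(1)] tree_word_in_carrier[OF t'] letter_in[OF s] .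
  note assoc = F.coset_mult_assoc[OF subgroup.subset[OF H_subgroup]]
  have "rev t \<otimes>\<^bsub>F\<^esub> (s # w) = rev t \<otimes>\<^bsub>F\<^esub> [s] \<otimes>\<^bsub>F\<^esub> w"
    using F.m_assoc[OF c(1) c(3) w] unfolding sw by (rule sym)
  then have "H #>\<^bsub>F\<^esub> (rev t \<otimes>\<^bsub>F\<^esub> (s # w)) = (H #>\<^bsub>F\<^esub> (rev t \<otimes>\<^bsub>F\<^esub> [s])) #>\<^bsub>F\<^esub> w"
    using assoc[OF F.m_closed[OF c(1) c(3)] w] by (simp only:)
  also have "\<dots> = H #>\<^bsub>F\<^esub> (rev ?t \<otimes>\<^bsub>F\<^esub> w)"
    unfolding coset_step[OF Cons.prems(1) s] by (rule assoc[OF c(2) w])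
  also have "\<dots> = H #>\<^bsub>F\<^esub> rev (act w ?t)" by (rule Cons.IH[OF t' w])
  finally show ?case by simp
qed

lemma coset_act_Nil: "w \<in> carrier F \<Longrightarrow> H #>\<^bsub>F\<^esub> w = H #>\<^bsub>F\<^esub> rev (act w [])"
  using coset_act[of "[]" w] F.l_one[of w] by (simp add: free_group_def)

lemma act_in_L_iff:
  assumes "w \<in> carrier F"
  shows "rev (act w []) \<in> L \<longleftrightarrow> w \<in> L"
proof -
  let ?v = "rev (act w [])"
  have v: "?v \<in> carrier F"
    using assms by (intro tree_word_in_carrier tree_word_act) (auto simp: free_group_def)
  have *: "a \<in> L" if "H #>\<^bsub>F\<^esub> a = H #>\<^bsub>F\<^esub> b" "b \<in> L" "a \<in> carrier F" for a b
  proof -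
    have "a \<in> H #>\<^bsub>F\<^esub> b"
      using F.rcos_self[OF that(3) H_subgroup] that(1) by simp
    then obtain h where "h \<in> H" "a = h \<otimes>\<^bsub>F\<^esub> b" by (auto simp: r_coset_def)
    then show ?thesis using H_subset_L subgroup.m_closed[OF subgroup] that(2) by blast
  qed
  show ?thesis using *[of w ?v] *[of ?v w] coset_act_Nil[OF assms] assms v by blast
qed

text \<open>
  The stabilizer of a vertex need not be normal in \<open>L\<close>. The elements of \<open>L\<close> that fix every vertex of
  the orbit of the root under \<open>L\<close> do form a normal subgroup, and it contains \<open>x\<close> because \<open>x\<close> is a loop
  at all of these vertices. Hence it contains the normal closure.
\<close>

lemma act_H:
  assumes h: "h \<in> H"
  shows "act h [] = []"
proof -
  let ?K = "{h \<in> L. \<forall>p\<in>L. act (p \<otimes>\<^bsub>F\<^esub> h) [] = act p []}"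
  have Lc: "p \<in> carrier F" if "p \<in> L" for p using that L_subset by blast
  note Lm = subgroup.m_closed[OF subgroup] and Li = subgroup.m_inv_closed[OF subgroup]
    and L1 = subgroup.one_closed[OF subgroup]
  interpret LG: group "F\<lparr>carrier := L\<rparr>" by (rule group_L)
  have "subgroup ?K (F\<lparr>carrier := L\<rparr>)"
  proof (rule LG.subgroupI)
    show "?K \<noteq> {}" using L1 Lc by auto
  next
    fix a assume a: "a \<in> ?K"
    have "act (p \<otimes>\<^bsub>F\<^esub> inv\<^bsub>F\<^esub> a) [] = act p []" if p: "p \<in> L" for p
    proof -
      have "act (p \<otimes>\<^bsub>F\<^esub> inv\<^bsub>F\<^esub> a \<otimes>\<^bsub>F\<^esub> a) [] = act (p \<otimes>\<^bsub>F\<^esub> inv\<^bsub>F\<^esub> a) []"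
        using a p Lm Li by blast
      moreover have "p \<otimes>\<^bsub>F\<^esub> inv\<^bsub>F\<^esub> a \<otimes>\<^bsub>F\<^esub> a = p"
        using a p Lc by (simp add: F.m_assoc)
      ultimately show ?thesis by simp
    qed
    then show "inv\<^bsub>F\<lparr>carrier := L\<rparr>\<^esub> a \<in> ?K" using a Li by (auto simp: inv_L)
  next
    fix a b assume ab: "a \<in> ?K" "b \<in> ?K"
    have "act (p \<otimes>\<^bsub>F\<^esub> (a \<otimes>\<^bsub>F\<^esub> b)) [] = act p []" if p: "p \<in> L" for p
    proof -
      have "act (p \<otimes>\<^bsub>F\<^esub> a \<otimes>\<^bsub>F\<^esub> b) [] = act p []" using ab p Lm by auto
      then show ?thesis using ab p Lc by (simp add: F.m_assoc)
    qed
    then show "a \<otimes>\<^bsub>F\<lparr>carrier := L\<rparr>\<^esub> b \<in> ?K" using ab Lm by auto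
  qed auto
  moreover have "p \<otimes>\<^bsub>F\<^esub> k \<otimes>\<^bsub>F\<^esub> inv\<^bsub>F\<^esub> p \<in> ?K" if p: "p \<in> L" and k: "k \<in> ?K" for p k
  proof -
    have "act (a \<otimes>\<^bsub>F\<^esub> (p \<otimes>\<^bsub>F\<^esub> k \<otimes>\<^bsub>F\<^esub> inv\<^bsub>F\<^esub> p)) [] = act a []" if a: "a \<in> L" for a
    proof -
      have c: "a \<in> carrier F" "p \<in> carrier F" "k \<in> carrier F" using a p k Lc by auto
      have "a \<otimes>\<^bsub>F\<^esub> (p \<otimes>\<^bsub>F\<^esub> k \<otimes>\<^bsub>F\<^esub> inv\<^bsub>F\<^esub> p) = (a \<otimes>\<^bsub>F\<^esub> p \<otimes>\<^bsub>F\<^esub> k) \<otimes>\<^bsub>F\<^esub> inv\<^bsub>F\<^esub> p"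
        using c by (simp add: F.m_assoc)
      then have "act (a \<otimes>\<^bsub>F\<^esub> (p \<otimes>\<^bsub>F\<^esub> k \<otimes>\<^bsub>F\<^esub> inv\<^bsub>F\<^esub> p)) []
          = act (inv\<^bsub>F\<^esub> p) (act (a \<otimes>\<^bsub>F\<^esub> p \<otimes>\<^bsub>F\<^esub> k) [])"
        using c act_mult[of "a \<otimes>\<^bsub>F\<^esub> p \<otimes>\<^bsub>F\<^esub> k" "inv\<^bsub>F\<^esub> p" "[]"] by simp
      also have "act (a \<otimes>\<^bsub>F\<^esub> p \<otimes>\<^bsub>F\<^esub> k) [] = act (a \<otimes>\<^bsub>F\<^esub> p) []" using k a p Lm by auto
      also have "act (inv\<^bsub>F\<^esub> p) (act (a \<otimes>\<^bsub>F\<^esub> p) []) = act (a \<otimes>\<^bsub>F\<^esub> p \<otimes>\<^bsub>F\<^esub> inv\<^bsub>F\<^esub> p) []"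
        using c act_mult[of "a \<otimes>\<^bsub>F\<^esub> p" "inv\<^bsub>F\<^esub> p" "[]"] by simp
      also have "a \<otimes>\<^bsub>F\<^esub> p \<otimes>\<^bsub>F\<^esub> inv\<^bsub>F\<^esub> p = a" using c by (simp add: F.m_assoc)
      finally show ?thesis .
    qed
    then show ?thesis using p k Lm Li by auto
  qed
  ultimately have "?K \<lhd> F\<lparr>carrier := L\<rparr>"
    by (intro LG.normal_invI) (simp_all add: inv_L)
  moreover have "free_gen x \<in> ?K"
  proof -
    have "act (p \<otimes>\<^bsub>F\<^esub> free_gen x) [] = act p []" if p: "p \<in> L" for p
      using p act_mult[of p "free_gen x" "[]"] Lc gen_in act_in_L_iff[of p]
      by (simp add: free_gen_def tree_step_def)
    then show ?thesis using gen_in by auto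
  qed
  ultimately have "H \<subseteq> ?K" unfolding H_eq by (intro normal_closure_least) auto
  then have "h \<in> L" "\<forall>p\<in>L. act (p \<otimes>\<^bsub>F\<^esub> h) [] = act p []" using h by auto
  then show ?thesis using L1 Lc[of h] F.l_one[of h] by (force simp: free_group_def)
qed

lemma act_rev_tree_word: "tree_word X x L t \<Longrightarrow> act (rev t) [] = t"
  by (induction t) (auto simp: tree_step_def cons_reduce_reduced)

lemma in_H_iff:
  assumes "w \<in> carrier F"
  shows "w \<in> H \<longleftrightarrow> act w [] = []"
proof
  assume "act w [] = []"
  then have "H #>\<^bsub>F\<^esub> w = H #>\<^bsub>F\<^esub> \<one>\<^bsub>F\<^esub>"
    using coset_act_Nil[OF assms] by (simp add: free_group_def)
  then show "w \<in> H"
    using F.rcos_self[OF assms H_subgroup] F.coset_mult_one[OF subgroup.subset[OF H_subgroup]] by simp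
qed (rule act_H)

lemma in_H_iff_retract: "rev r \<in> carrier F \<Longrightarrow> rev r \<in> H \<longleftrightarrow> retract x L r = []"
  using in_H_iff[of "rev r"] by (simp add: retract_def foldr_conv_fold)

lemma tree_word_retract: "fst ` set r \<subseteq> X \<Longrightarrow> tree_word X x L (retract x L r)"
  by (induction r) (auto simp: tree_word_step)

lemma length_act: "length (act w t) \<le> length w + length t"
proof (induction w arbitrary: t)
  case (Cons s w)
  have "length (tree_step x L s t) \<le> Suc (length t)"
    using length_cons_reduce[of s t] by (auto simp: tree_step_def)
  then show ?case using Cons[of "tree_step x L s t"] by simp
qed simp

text \<open>
  If \<open>t = h u\<close> with \<open>h\<close> in \<open>H\<close>, then \<open>h\<close> fixes the root, so \<open>t\<close> and \<open>u\<close> take the root to the same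
  vertex. As a tree word leads to itself, the two are equal.
\<close>

lemma inj_coset: "inj_on (\<lambda>t. H #>\<^bsub>F\<^esub> rev t) {t. tree_word X x L t}"
proof (rule inj_onI, clarsimp)
  fix t u assume t: "tree_word X x L t" and u: "tree_word X x L u"
    and eq: "H #>\<^bsub>F\<^esub> rev t = H #>\<^bsub>F\<^esub> rev u"
  have c: "rev t \<in> carrier F" "rev u \<in> carrier F" using t u tree_word_in_carrier by auto
  have "rev t \<in> H #>\<^bsub>F\<^esub> rev u" using F.rcos_self[OF c(1) H_subgroup] eq by simp
  then obtain h where h: "h \<in> H" "rev t = h \<otimes>\<^bsub>F\<^esub> rev u" by (auto simp: r_coset_def)
  then have "act (rev t) [] = act (rev u) (act h [])"
    using act_mult[of h "rev u" "[]"] c subgroup.mem_carrier[OF H_subgroup] by simp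
  then show "t = u" using t u act_H[OF h(1)] by (simp add: act_rev_tree_word)
qed

theorem cogrowth_eq_card_tree_words:
  "cogrowth F (free_gen ` X) H n = card {t. tree_word X x L t \<and> length t \<le> n}" (is "_ = card ?T")
proof -
  have "{H #>\<^bsub>F\<^esub> g | g. g \<in> carrier F \<and> word_length F (free_gen ` X) g \<le> n}
      = (\<lambda>t. H #>\<^bsub>F\<^esub> rev t) ` ?T" (is "?A = ?B")
  proof
    show "?A \<subseteq> ?B"
    proof clarify
      fix g assume g: "g \<in> carrier F" "word_length F (free_gen ` X) g \<le> n"
      have "tree_word X x L (act g [])" using g by (intro tree_word_act) (auto simp: free_group_def)
      moreover have "length (act g []) \<le> n"
        using g length_act[of g "[]"] by (simp add: word_length_free_group)
      ultimately show "H #>\<^bsub>F\<^esub> g \<in> ?B"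
        using coset_act_Nil[OF g(1)] by auto
    qed
    show "?B \<subseteq> ?A"
    proof clarify
      fix t assume "tree_word X x L t" "length t \<le> n"
      then show "\<exists>g. H #>\<^bsub>F\<^esub> rev t = H #>\<^bsub>F\<^esub> g \<and> g \<in> carrier F \<and> word_length F (free_gen ` X) g \<le> n"
        using tree_word_in_carrier[of t] word_length_free_group[of "rev t" X]
        by (intro exI[of _ "rev t"]) simp
    qed
  qed
  moreover have "inj_on (\<lambda>t. H #>\<^bsub>F\<^esub> rev t) ?T"
    using inj_coset by (rule inj_on_subset) auto
  ultimately show ?thesis by (simp add: cogrowth_def card_image)
qed

end

section \<open>Counting tree words level by level\<close>

definition tree_level :: "'a set \<Rightarrow> 'a \<Rightarrow> 'a letter list set \<Rightarrow> nat \<Rightarrow> 'a letter list set" where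
  "tree_level X x L n = {t. tree_word X x L t \<and> length t = n}"

definition children :: "'a set \<Rightarrow> 'a \<Rightarrow> 'a letter list set \<Rightarrow> 'a letter list \<Rightarrow> 'a letter set" where
  "children X x L t = {s. tree_word X x L (s # t)}"

definition extensions :: "'a set \<Rightarrow> 'a letter list \<Rightarrow> 'a letter set" where
  "extensions X t = {s. fst s \<in> X \<and> reduced (s # t)}"

lemma tree_word_letters: "tree_word X x L t \<Longrightarrow> reduced t \<and> fst ` set t \<subseteq> X"
  by (induction t) auto

lemma children_subset_extensions: "children X x L t \<subseteq> extensions X t"
  by (auto simp: children_def extensions_def)

lemma children_eq_extensions:
  "tree_word X x L t \<Longrightarrow> rev t \<notin> L \<Longrightarrow> children X x L t = extensions X t"
  by (auto simp: children_def extensions_def)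

lemma extensions_eq:
  assumes "reduced t" and "t \<noteq> []"
  shows "extensions X t = X \<times> UNIV - {inv_letter (hd t)}"
proof -
  have "s \<noteq> inv_letter (hd t) \<longleftrightarrow> hd t \<noteq> inv_letter s" for s
    by (metis inv_letter_simps(1))
  then show ?thesis using assms by (auto simp: extensions_def reduced_Cons)
qed

lemma finite_extensions: "finite X \<Longrightarrow> finite (extensions X t)"
  by (rule finite_subset[of _ "X \<times> UNIV"]) (auto simp: extensions_def)

lemma finite_children: "finite X \<Longrightarrow> finite (children X x L t)"
  by (rule finite_subset[OF children_subset_extensions finite_extensions])

lemma card_extensions:
  assumes "finite X" and "tree_word X x L t" and "t \<noteq> []"
  shows "card (extensions X t) = 2 * card X - 1"
proof -
  have "inv_letter (hd t) \<in> X \<times> UNIV"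
    using assms(2,3) by (cases t) (auto simp: mem_Times_iff)
  then show ?thesis
    using assms tree_word_letters[OF assms(2)]
    by (simp add: extensions_eq card_Diff_singleton card_cartesian_product)
qed

lemma tree_level_0 [simp]: "tree_level X x L 0 = {[]}"
  by (auto simp: tree_level_def)

lemma tree_level_Suc:
  "tree_level X x L (Suc n) = (\<lambda>(t, s). s # t) ` (SIGMA t:tree_level X x L n. children X x L t)"
  by (auto simp: tree_level_def children_def length_Suc_conv image_iff)

lemma finite_tree_level: "finite X \<Longrightarrow> finite (tree_level X x L n)"
  by (induction n) (auto simp: tree_level_Suc intro!: finite_imageI finite_SigmaI finite_children)

lemma sum_tree_level_Suc:
  assumes "finite X"
  shows "sum f (tree_level X x L (Suc n))
       = (\<Sum>t\<in>tree_level X x L n. \<Sum>s\<in>children X x L t. f (s # t))"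
proof -
  have "sum f (tree_level X x L (Suc n))
      = (\<Sum>(t, s)\<in>(SIGMA t:tree_level X x L n. children X x L t). f (s # t))"
    unfolding tree_level_Suc
    by (subst sum.reindex) (auto simp: inj_on_def case_prod_unfold comp_def)
  then show ?thesis
    using assms by (simp add: sum.Sigma finite_tree_level finite_children)
qed

lemma card_tree_ball:
  assumes "finite X"
  shows "card {t. tree_word X x L t \<and> length t \<le> n} = (\<Sum>j\<le>n. card (tree_level X x L j))"
proof -
  have "{t. tree_word X x L t \<and> length t \<le> n} = (\<Union>j\<le>n. tree_level X x L j)"
    by (auto simp: tree_level_def)
  moreover have "card (\<Union>j\<le>n. tree_level X x L j) = (\<Sum>j\<le>n. card (tree_level X x L j))"
    by (rule card_UN_disjoint) (auto simp: finite_tree_level[OF assms], auto simp: tree_level_def)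
  ultimately show ?thesis by simp
qed

lemma card_tree_level_Suc_le:
  assumes "finite X" and "n > 0"
  shows "card (tree_level X x L (Suc n)) \<le> (2 * card X - 1) * card (tree_level X x L n)"
proof -
  have "card (tree_level X x L (Suc n)) = (\<Sum>t\<in>tree_level X x L n. card (children X x L t))"
    using sum_tree_level_Suc[OF assms(1), of "\<lambda>_. 1::nat" x L n] by simp
  also have "\<dots> \<le> (\<Sum>t\<in>tree_level X x L n. 2 * card X - 1)"
  proof (rule sum_mono)
    fix t assume t: "t \<in> tree_level X x L n"
    then have "tree_word X x L t" "t \<noteq> []" using assms(2) by (auto simp: tree_level_def)
    then show "card (children X x L t) \<le> 2 * card X - 1"
      using card_extensions[OF assms(1), of x L t]
        card_mono[OF finite_extensions[OF assms(1), of t] children_subset_extensions[of X x L t]]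
      by simp
  qed
  finally show ?thesis by (simp add: mult.commute)
qed

lemma card_tree_level_le:
  assumes "finite X" and "card X \<ge> 1"
  shows "card (tree_level X x L n) \<le> 2 * (2 * card X - 1) ^ n"
proof (induction n)
  case (Suc n)
  show ?case
  proof (cases "n = 0")
    case True
    have "card (tree_level X x L (Suc 0)) = card (children X x L [])"
      using sum_tree_level_Suc[OF assms(1), of "\<lambda>_. 1::nat" x L 0] by simp
    also have "\<dots> \<le> card (X \<times> (UNIV :: bool set))"
      using assms(1) by (intro card_mono) (auto simp: children_def mem_Times_iff)
    also have "\<dots> \<le> 2 * (2 * card X - 1)" using assms(2) by (simp add: card_cartesian_product)
    finally show ?thesis using True by simp
  next
    case False
    then have "card (tree_level X x L (Suc n)) \<le> (2 * card X - 1) * card (tree_level X x L n)"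
      by (intro card_tree_level_Suc_le[OF assms(1)]) simp
    also have "\<dots> \<le> (2 * card X - 1) * (2 * (2 * card X - 1) ^ n)"
      by (rule mult_left_mono[OF Suc]) simp
    finally show ?thesis by (simp only: power_Suc mult.left_commute)
  qed
qed simp

text \<open>
  A function whose sum over the children of a word is at least \<open>d\<close> times its value gains a factor \<open>d\<close>
  per level. Being at most \<open>1\<close>, it bounds the number of words from below.
\<close>

lemma card_tree_level_ge:
  fixes \<psi> :: "'a letter list \<Rightarrow> real" and d :: real
  assumes "finite X" and "d \<ge> 0" and le: "\<And>t. \<psi> t \<le> 1"
    and sub: "\<And>t. tree_word X x L t \<Longrightarrow> t \<noteq> [] \<Longrightarrow> d * \<psi> t \<le> (\<Sum>s\<in>children X x L t. \<psi> (s # t))"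
  shows "d ^ n * (\<Sum>s\<in>children X x L []. \<psi> [s]) \<le> card (tree_level X x L (Suc n))"
proof -
  have "d ^ n * (\<Sum>s\<in>children X x L []. \<psi> [s]) \<le> sum \<psi> (tree_level X x L (Suc n))"
  proof (induction n)
    case 0
    then show ?case by (simp add: sum_tree_level_Suc[OF assms(1)])
  next
    case (Suc n)
    have "d ^ Suc n * (\<Sum>s\<in>children X x L []. \<psi> [s]) \<le> d * sum \<psi> (tree_level X x L (Suc n))"
      using mult_left_mono[OF Suc \<open>d \<ge> 0\<close>] by (simp add: mult_ac)
    also have "\<dots> = (\<Sum>t\<in>tree_level X x L (Suc n). d * \<psi> t)" by (rule sum_distrib_left)
    also have "\<dots> \<le> (\<Sum>t\<in>tree_level X x L (Suc n). \<Sum>s\<in>children X x L t. \<psi> (s # t))"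
      by (rule sum_mono, rule sub) (auto simp: tree_level_def)
    also have "\<dots> = sum \<psi> (tree_level X x L (Suc (Suc n)))"
      by (simp only: sum_tree_level_Suc[OF assms(1), of _ _ _ "Suc n"])
    finally show ?case .
  qed
  also have "\<dots> \<le> card (tree_level X x L (Suc n))"
    using sum_mono[of "tree_level X x L (Suc n)" \<psi> "\<lambda>_. 1"] le by simp
  finally show ?thesis .
qed

text \<open>
  The criterion for maximal cogrowth, with \<open>\<psi>\<close> in the role of a lower bound for the survival
  probability.
\<close>

lemma maximal_growth:
  fixes \<psi> :: "'a letter list \<Rightarrow> real"
  assumes "finite X" and "card X \<ge> 2" and "\<And>t. \<psi> t \<le> 1"
    and sub: "\<And>t. tree_word X x L t \<Longrightarrow> t \<noteq> [] \<Longrightarrow>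
       (2 * real (card X) - 1) * \<psi> t \<le> (\<Sum>s\<in>children X x L t. \<psi> (s # t))"
    and pos: "(\<Sum>s\<in>children X x L []. \<psi> [s]) > 0"
  shows "(\<lambda>n. real (card {t. tree_word X x L t \<and> length t \<le> n})) \<in> \<Theta>(\<lambda>n. (2 * real (card X) - 1) ^ n)"
proof -
  define d where "d = 2 * real (card X) - 1"
  define c where "c = (\<Sum>s\<in>children X x L []. \<psi> [s])"
  have d: "d \<ge> 3" using assms(2) by (simp add: d_def)
  have dn: "real (2 * card X - 1) = d" using assms(2) by (simp add: d_def of_nat_diff)
  define b where "b n = (\<Sum>j\<le>n. card (tree_level X x L j))" for n
  have upper: "real (b n) \<le> 4 * d ^ n" for n
  proof (induction n)
    case (Suc n)
    have "real (card (tree_level X x L (Suc n))) \<le> real (2 * (2 * card X - 1) ^ Suc n)"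
      using card_tree_level_le[of X x L "Suc n"] assms(1,2) by (intro of_nat_mono) auto
    also have "\<dots> = 2 * (d * d ^ n)" by (simp only: of_nat_mult of_nat_power dn power_Suc of_nat_numeral)
    finally have "real (b (Suc n)) \<le> 4 * d ^ n + 2 * (d * d ^ n)" using Suc by (simp add: b_def)
    moreover have "2 * d ^ n \<le> d * d ^ n" using d by (intro mult_right_mono) auto
    ultimately show ?case by simp
  qed (simp add: b_def)
  have lower: "c / d * d ^ n \<le> real (b n)" if "n \<ge> 1" for n
  proof -
    obtain k where k: "n = Suc k" using \<open>n \<ge> 1\<close> by (cases n) auto
    have "c / d * d ^ n = d ^ k * c" using d by (simp add: k)
    also have "\<dots> \<le> card (tree_level X x L n)"
      unfolding c_def k
      by (rule card_tree_level_ge) (use assms sub d in \<open>auto simp: d_def\<close>)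
    also have "\<dots> \<le> real (b n)"
      using member_le_sum[of n "{..n}" "\<lambda>j. card (tree_level X x L j)"] by (intro of_nat_mono) (auto simp: b_def)
    finally show ?thesis .
  qed
  have "(\<lambda>n. real (b n)) \<in> \<Theta>(\<lambda>n. d ^ n)"
  proof (rule bigthetaI)
    show "(\<lambda>n. real (b n)) \<in> O(\<lambda>n. d ^ n)"
      using upper d by (intro bigoI[of _ 4]) (auto intro!: always_eventually)
    have "norm (d ^ n) \<le> d / c * norm (real (b n))" if "n \<ge> 1" for n
    proof -
      have "d / c * (c / d * d ^ n) \<le> d / c * real (b n)"
        using lower[OF that] pos d by (intro mult_left_mono) (auto simp: c_def)
      then show ?thesis using pos d by (simp add: c_def)
    qed
    then show "(\<lambda>n. real (b n)) \<in> \<Omega>(\<lambda>n. d ^ n)"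
      unfolding bigomega_iff_bigo
      by (intro bigoI[of _ "d / c"] eventually_mono[OF eventually_ge_at_top[of 1]])
  qed
  then show ?thesis by (simp add: card_tree_ball[OF assms(1)] b_def d_def)
qed

section \<open>Transience in rank at least three\<close>

lemma length_cons_reduce_eq:
  "length (cons_reduce s u) = (if u \<noteq> [] \<and> s = inv_letter (hd u) then length u - 1 else Suc (length u))"
proof (cases u)
  case (Cons a v)
  have "a = inv_letter s \<longleftrightarrow> s = inv_letter a" by (metis inv_letter_simps(1))
  then show ?thesis by (simp add: Cons cons_reduce_def)
qed (simp add: cons_reduce_def)

lemma sum_indicator_le:
  fixes c :: real
  assumes "finite E" and "c \<ge> 0" and "finite B" and "{s \<in> E. P s} \<subseteq> B"
  shows "(\<Sum>s\<in>E. if P s then c else 0) \<le> c * card B"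
proof -
  have "(\<Sum>s\<in>E. if P s then c else 0) = (\<Sum>s\<in>{s \<in> E. P s}. c)"
    by (rule sum.inter_filter[OF assms(1), symmetric])
  also have "\<dots> \<le> c * card B"
    using card_mono[OF assms(3,4)] assms(2) by (simp add: mult.commute mult_left_mono)
  finally show ?thesis .
qed

text \<open>
  Erasing the letters \<open>x\<close> maps \<open>F\<close> onto the free group on the remaining generators, with kernel
  \<open>H\<close>. Of the \<open>2m - 1\<close> letters that may follow a word, at most two keep the length of the image, at most
  one decreases it, and all the others increase it. The sum of \<open>2\<^sup>-\<^sup>d\<close> over the continuations is thus at
  most \<open>((2m - 1)/2 + 2/2 + 3/2) 2\<^sup>-\<^sup>d = (m + 2) 2\<^sup>-\<^sup>d\<close>, and \<open>m + 2 \<le> 2m - 1\<close> for \<open>m \<ge> 3\<close>.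
\<close>

lemma maximal_growth_rank_ge_3:
  assumes "closure_in_subgroup X x (carrier (free_group X)) H"
    and X: "finite X" "card X \<ge> 3" and L: "L \<subseteq> H"
  shows "(\<lambda>n. real (card {t. tree_word X x L t \<and> length t \<le> n})) \<in> \<Theta>(\<lambda>n. (2 * real (card X) - 1) ^ n)"
proof -
  let ?F = "free_group X"
  interpret closure_in_subgroup X x "carrier ?F" H by fact
  define \<pi> where "\<pi> = retract x (carrier ?F)"
  define \<phi> where "\<phi> t = (1 / 2 :: real) ^ length (\<pi> t)" for t
  have step: "\<pi> (s # t) = (if fst s = x then \<pi> t else cons_reduce s (\<pi> t))"
    if "fst ` set t \<subseteq> X" for s t
    using tree_word_in_carrier[OF tree_word_retract[OF that]] by (simp add: \<pi>_def tree_step_def)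
  have sub: "(2 * real (card X) - 1) * (1 - \<phi> t) \<le> (\<Sum>s\<in>children X x L t. 1 - \<phi> (s # t))"
    if t: "tree_word X x L t" "t \<noteq> []" for t
  proof (cases "\<pi> t = []")
    case True
    have "\<phi> (s # t) \<le> 1" for s by (simp add: \<phi>_def power_le_one)
    then show ?thesis using True by (auto simp: \<phi>_def intro!: sum_nonneg)
  next
    case False
    note letters = tree_word_letters[OF t(1)]
    let ?E = "extensions X t"
    have fin: "finite ?E" using X by (simp add: finite_extensions)
    have card: "real (card ?E) = 2 * real (card X) - 1"
      using card_extensions[OF X(1) t] X(2) by (simp add: of_nat_diff)
    have "rev t \<in> carrier ?F" using letters by (simp add: free_group_def)
    then have "rev t \<notin> L" using False L in_H_iff_retract[of t] by (auto simp: \<pi>_def)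
    then have ch: "children X x L t = ?E" using children_eq_extensions t(1) by metis
    \<comment> \<open>The factors are \<open>1\<close> for \<open>x\<close>, \<open>2\<close> for the cancelling letter, \<open>1 / 2\<close> for the rest.\<close>
    have "\<phi> (s # t) \<le> \<phi> t * (1 / 2 + (if fst s = x then 1 / 2 else 0)
        + (if s = inv_letter (hd (\<pi> t)) then 3 / 2 else 0))" for s
    proof -
      obtain k where k: "length (\<pi> t) = Suc k" using False by (cases "\<pi> t") auto
      show ?thesis using False letters by (simp add: step \<phi>_def length_cons_reduce_eq k)
    qed
    then have "(\<Sum>s\<in>?E. \<phi> (s # t)) \<le> (\<Sum>s\<in>?E. \<phi> t * (1 / 2 + (if fst s = x then 1 / 2 else 0)
        + (if s = inv_letter (hd (\<pi> t)) then 3 / 2 else 0)))"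
      by (intro sum_mono)
    also have "\<dots> = \<phi> t * (real (card ?E) / 2 + (\<Sum>s\<in>?E. if fst s = x then 1 / 2 else 0)
        + (\<Sum>s\<in>?E. if s = inv_letter (hd (\<pi> t)) then 3 / 2 else 0))"
      by (simp only: sum_distrib_left[symmetric] sum.distrib sum_constant) simp
    also have "\<dots> \<le> \<phi> t * (real (card ?E) / 2 + 1 / 2 * real (card ({x} \<times> (UNIV :: bool set)))
        + 3 / 2 * real (card {inv_letter (hd (\<pi> t))}))"
      using fin by (intro mult_left_mono add_mono order_refl sum_indicator_le)
        (auto simp: \<phi>_def mem_Times_iff)
    also have "\<dots> = \<phi> t * (real (card ?E) / 2 + 5 / 2)"
      by (simp add: card_cartesian_product)
    also have "\<dots> \<le> \<phi> t * real (card ?E)"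
    proof (rule mult_left_mono)
      have "5 \<le> e \<Longrightarrow> e / 2 + 5 / 2 \<le> e" for e :: real by simp
      moreover have "5 \<le> real (card ?E)" using card_extensions[OF X(1) t] X(2) by simp
      ultimately show "real (card ?E) / 2 + 5 / 2 \<le> real (card ?E)" .
    qed (simp add: \<phi>_def)
    finally have "(\<Sum>s\<in>?E. \<phi> (s # t)) \<le> \<phi> t * real (card ?E)" .
    then show ?thesis unfolding ch card[symmetric] by (simp add: sum_subtractf algebra_simps)
  qed
  obtain y where y: "y \<in> X" "y \<noteq> x"
  proof -
    have "\<not> X \<subseteq> {x}" using X(2) card_mono[of "{x}" X] by auto
    then show ?thesis using that by blast
  qed
  have "0 < (\<Sum>s\<in>children X x L []. 1 - \<phi> [s])"
  proof (rule sum_pos2)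
    show "finite (children X x L [])" using X(1) by (rule finite_children)
    show "(y, True) \<in> children X x L []" using y by (simp add: children_def reduced_Cons)
    show "0 < 1 - \<phi> [(y, True)]" using y step[of "[]" "(y, True)"] by (simp add: \<phi>_def \<pi>_def cons_reduce_def)
  qed (simp add: \<phi>_def power_le_one)
  then show ?thesis
    using X sub by (intro maximal_growth[where \<psi> = "\<lambda>t. 1 - \<phi> t"]) (auto simp: \<phi>_def)
qed

section \<open>The normal closure in rank two\<close>

definition height :: "'a \<Rightarrow> 'a letter list \<Rightarrow> int" where
  "height x t = (\<Sum>s\<leftarrow>t. if fst s = x then 0 else if snd s then 1 else - 1)"

lemma height_simps [simp]:
  "height x [] = 0"
  "height x (s # t) = (if fst s = x then 0 else if snd s then 1 else - 1) + height x t"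
  by (simp_all add: height_def)

lemma height_cons_reduce: "height x (cons_reduce s t) = height x (s # t)"
  by (cases t) (auto simp: cons_reduce_def inv_letter_def)

locale rank_two = closure_in_subgroup X x "carrier (free_group X)" H
  for X :: "'a set" and x :: 'a and H :: "'a letter list set" +
  fixes y :: 'a
  assumes X_eq: "X = {x, y}" and neq: "x \<noteq> y"
begin

text \<open>
  Erasing the letters \<open>x\<close> leaves a reduced word in the single generator \<open>y\<close>, that is, a power of \<open>y\<close>,
  and the exponent of this power is the height.
\<close>

lemma in_H_iff_height:
  assumes "rev t \<in> carrier F"
  shows "rev t \<in> H \<longleftrightarrow> height x t = 0"
proof -
  let ?\<pi> = "retract x (carrier F)"
  have letters: "fst ` set t \<subseteq> X" using assms by (auto simp: free_group_def)
  then have h: "height x (?\<pi> t) = height x t"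
    by (induction t) (auto simp: tree_step_def height_cons_reduce)
  have "\<exists>b. u = replicate (length u) (y, b)" if "tree_word X x (carrier F) u" for u
    using that
  proof (induction u)
    case (Cons s u)
    obtain b where b: "u = replicate (length u) (y, b)" using Cons by auto
    have s: "fst s = y" using Cons.prems tree_word_in_carrier[of u] X_eq by auto
    show ?case
    proof (cases u)
      case Nil
      then show ?thesis using s by (auto simp: prod_eq_iff)
    next
      case u: (Cons s' u')
      then have "s' = (y, b)" using b by simp
      then have "s = (y, b)"
        using Cons.prems s u by (auto simp: reduced_Cons inv_letter_def prod_eq_iff)
      then show ?thesis using b by auto
    qed
  qed simp
  from this[OF tree_word_retract[OF letters]] obtain b n where b: "?\<pi> t = replicate n (y, b)" by metis
  have "height x (replicate n (y, b)) = (if b then int n else - int n)" for n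
    using neq by (induction n) auto
  then have "height x (?\<pi> t) = 0 \<longleftrightarrow> ?\<pi> t = []"
    unfolding b by simp
  then show ?thesis using h in_H_iff_retract[OF assms] by simp
qed

lemma sum_extensions:
  fixes f :: "'a letter \<Rightarrow> 'b :: comm_monoid_add"
  assumes t: "tree_word X x L t" "t \<noteq> []"
  shows "sum f (extensions X t) = (if fst (hd t) = x
     then f (hd t) + f (y, b) + f (y, \<not> b) else f (hd t) + f (x, b) + f (x, \<not> b))"
proof -
  obtain a c where hd: "hd t = (a, c)" by force
  have a: "a \<in> {x, y}" using t hd X_eq by (cases t) auto
  have "extensions X t = X \<times> UNIV - {(a, \<not> c)}"
    using extensions_eq[of t X] tree_word_letters[OF t(1)] t(2) hd by (simp add: inv_letter_def)
  also have "\<dots> = (if a = x then {(a, c), (y, b), (y, \<not> b)} else {(a, c), (x, b), (x, \<not> b)})"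
    using a neq by (auto simp: X_eq)
  finally show ?thesis using hd a neq by (auto simp: add.assoc)
qed

end

section \<open>Transience over the second closure in rank two\<close>

context rank_two begin

lemma card_X: "card X = 2" "finite X"
  using neq by (auto simp: X_eq)

text \<open>At height \<open>0\<close> the edges labelled \<open>x\<close> are loops, so no tree word ends with one.\<close>

lemma hd_tree_word_height_0:
  assumes "tree_word X x H u" and "u \<noteq> []" and "height x u = 0"
  shows "fst (hd u) = y"
proof (cases u)
  case (Cons s v)
  have "rev v \<in> carrier F"
    using tree_word_letters[of X x H v] assms(1) Cons by (simp add: free_group_def)
  then show ?thesis
    using assms Cons in_H_iff_height[of v] X_eq by auto
qed (use assms in simp)

text \<open>
  The superharmonic function is \<open>(3/4)\<^sup>d c\<close>, where \<open>d\<close> is the distance of the current vertex \<open>u\<close> from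
  the root and \<open>c\<close> is a correction factor. The last letter of the word \<open>t\<close> agrees with that of \<open>u\<close> when
  the walk has just moved away from the root. Then it cannot turn back, because it never backtracks,
  and a smaller \<open>c\<close> suffices. With \<open>A\<close>, \<open>B\<close> for arriving away from and towards the root, and
  \<open>A'\<close>, \<open>B'\<close>, \<open>C'\<close> for arriving at a vertex with loops away from the root, towards it, or by a loop, the
  values \<open>A = A' = 1\<close>, \<open>B = C' = 9/8\<close>, \<open>B' = 5/4\<close> satisfy the required inequalities:
  \<open>3 (3/4) \<le> 3 A\<close>, \<open>(4/3) (5/4) + 2 (3/4) \<le> 3 B\<close>, \<open>3/4 + 2 C' \<le> 3 A'\<close>, \<open>(4/3) B + 2 C' \<le> 3 B'\<close> and
  \<open>3/4 + (4/3) B + C' \<le> 3 C'\<close>.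
\<close>

lemma maximal_growth_rank_two:
  assumes "closure_in_subgroup X x H H2" and L: "L \<subseteq> H2"
  shows "(\<lambda>n. real (card {t. tree_word X x L t \<and> length t \<le> n})) \<in> \<Theta>(\<lambda>n. (2 * real (card X) - 1) ^ n)"
proof -
  interpret second: closure_in_subgroup X x H H2 by fact
  define \<rho> where "\<rho> = retract x H"
  define c :: "'a letter list \<Rightarrow> 'a letter list \<Rightarrow> real" where
    "c t u = (if height x u \<noteq> 0 then if hd t = hd u then 1 else 9 / 8
              else if fst (hd t) = x then 9 / 8 else if hd t = hd u then 1 else 5 / 4)" for t u
  define \<phi> :: "'a letter list \<Rightarrow> real" where
    "\<phi> t = (if \<rho> t = [] then 1 else (3 / 4) ^ length (\<rho> t) * c t (\<rho> t))" for t
  have c_bounds: "0 \<le> c t u" "c t u \<le> 5 / 4" for t u by (auto simp: c_def)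
  have nonneg: "0 \<le> \<phi> t" for t using c_bounds by (simp add: \<phi>_def)
  have tree_\<rho>: "tree_word X x H (\<rho> t)" if "fst ` set t \<subseteq> X" for t
    using second.tree_word_retract[OF that] by (simp add: \<rho>_def)
  have step: "\<rho> (s # t) = (if fst s = x \<and> height x (\<rho> t) = 0 then \<rho> t else cons_reduce s (\<rho> t))"
    if "fst ` set t \<subseteq> X" for s t
    using in_H_iff_height[OF second.tree_word_in_carrier[OF tree_\<rho>[OF that]]]
    by (simp add: \<rho>_def tree_step_def)
  have from_root: "\<phi> (s # t) = (if fst s = x then 1 else 3 / 4)"
    if "fst ` set t \<subseteq> X" "\<rho> t = []" for s t
    using that by (simp add: \<phi>_def step c_def cons_reduce_def)
  have sub: "(2 * real (card X) - 1) * (1 - \<phi> t) \<le> (\<Sum>s\<in>children X x L t. 1 - \<phi> (s # t))"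
    if t: "tree_word X x L t" "t \<noteq> []" for t
  proof (cases "\<rho> t = []")
    case True
    then show ?thesis
      using from_root[of t] tree_word_letters[OF t(1)] by (auto simp: \<phi>_def[of t] intro!: sum_nonneg)
  next
    case False
    define u where "u = \<rho> t"
    define \<Lambda> :: real where "\<Lambda> = (3 / 4) ^ length u"
    let ?E = "extensions X t"
    have letters: "fst ` set t \<subseteq> X" "reduced t" using tree_word_letters[OF t(1)] by auto
    have u: "u \<noteq> []" "tree_word X x H u" using False tree_\<rho>[OF letters(1)] by (simp_all add: u_def)
    have \<Lambda>: "\<Lambda> \<ge> 0" by (simp add: \<Lambda>_def)
    have \<phi>t: "\<phi> t = \<Lambda> * c t u" using False by (simp add: \<phi>_def \<Lambda>_def u_def)
    have carrier: "rev t \<in> carrier F" using letters by (simp add: free_group_def)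
    then have "rev t \<notin> L"
      using False L second.in_H_iff_retract[of t] by (auto simp: \<rho>_def)
    then have ch: "children X x L t = ?E" using children_eq_extensions t(1) by metis
    have card: "card ?E = 3" using card_extensions[OF card_X(2) t] card_X(1) by simp
    have push: "\<phi> (s # t) = \<Lambda> * (3 / 4)"
      if "\<not> (fst s = x \<and> height x u = 0)" "s \<noteq> inv_letter (hd u)" for s
    proof -
      have "cons_reduce s u = s # u"
        using that(2) by (cases u) (auto simp: cons_reduce_def)
      then have "\<rho> (s # t) = s # u" using that(1) step[OF letters(1)] by (auto simp: u_def)
      then show ?thesis using that(1) by (auto simp: \<phi>_def c_def \<Lambda>_def)
    qed
    have pop: "\<phi> (s # t) \<le> \<Lambda> * (5 / 3)" "height x u = 0 \<longrightarrow> \<phi> (s # t) \<le> \<Lambda> * (3 / 2)"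
      if "\<not> (fst s = x \<and> height x u = 0)" "s = inv_letter (hd u)" for s
    proof -
      obtain a v where uv: "u = a # v" using u(1) by (cases u) auto
      have \<rho>': "\<rho> (s # t) = v"
        using that step[OF letters(1)] by (auto simp: u_def[symmetric] uv cons_reduce_def)
      have "height x v \<noteq> 0" if "height x u = 0"
        using hd_tree_word_height_0[OF u(2,1) that] that neq by (auto simp: uv split: if_splits)
      then show "\<phi> (s # t) \<le> \<Lambda> * (5 / 3)" "height x u = 0 \<longrightarrow> \<phi> (s # t) \<le> \<Lambda> * (3 / 2)"
        using c_bounds(2)[of "s # t" v] by (auto simp: \<phi>_def \<rho>' \<Lambda>_def uv c_def)
    qed
    have loop: "\<phi> (s # t) = \<Lambda> * (9 / 8)" if "fst s = x" "height x u = 0" for s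
      using that step[OF letters(1)] u(1) by (simp add: \<phi>_def c_def \<Lambda>_def u_def)
    have "(\<Sum>s\<in>?E. \<phi> (s # t)) \<le> 3 * \<phi> t"
    proof (cases "height x u = 0")
      case k: False
      show ?thesis
      proof (cases "hd t = hd u")
        case True
        have "(\<Sum>s\<in>?E. \<phi> (s # t)) = (\<Sum>s\<in>?E. \<Lambda> * (3 / 4))"
          using extensions_eq[OF letters(2) t(2)] True k by (intro sum.cong push) auto
        then show ?thesis using k True \<Lambda> card by (simp add: \<phi>t c_def)
      next
        case no: False
        have "\<phi> (s # t) \<le> \<Lambda> * (3 / 4) + (if s = inv_letter (hd u) then \<Lambda> * (11 / 12) else 0)" for s
          using push[of s] pop(1)[of s] k by auto
        then have "(\<Sum>s\<in>?E. \<phi> (s # t))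
            \<le> (\<Sum>s\<in>?E. \<Lambda> * (3 / 4) + (if s = inv_letter (hd u) then \<Lambda> * (11 / 12) else 0))"
          by (intro sum_mono)
        also have "\<dots> \<le> \<Lambda> * (9 / 4) + \<Lambda> * (11 / 12) * real (card {inv_letter (hd u)})"
          unfolding sum.distrib using \<Lambda> card finite_extensions[OF card_X(2)]
          by (intro add_mono sum_indicator_le) auto
        finally show ?thesis using k no \<Lambda> by (simp add: \<phi>t c_def)
      qed
    next
      case k: True
      obtain b where b: "hd u = (y, b)"
        using hd_tree_word_height_0[OF u(2,1) k] by (metis prod.collapse)
      have away: "\<phi> ((y, b) # t) = \<Lambda> * (3 / 4)"
        by (rule push) (use neq b in \<open>simp_all add: inv_letter_def\<close>)
      have toward: "\<phi> ((y, \<not> b) # t) \<le> \<Lambda> * (3 / 2)"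
        by (rule pop(2)[rule_format, OF _ _ k]) (use neq b in \<open>simp_all add: inv_letter_def\<close>)
      show ?thesis
      proof (cases "fst (hd t) = x")
        case True
        have "(\<Sum>s\<in>?E. \<phi> (s # t)) = \<phi> (hd t # t) + \<phi> ((y, b) # t) + \<phi> ((y, \<not> b) # t)"
          using sum_extensions[OF t, of "\<lambda>s. \<phi> (s # t)" b] True by simp
        moreover have "\<phi> (hd t # t) = \<Lambda> * (9 / 8)" by (rule loop[OF True k])
        moreover have "\<phi> t = \<Lambda> * (9 / 8)" using True k by (simp add: \<phi>t c_def)
        ultimately show ?thesis using away toward by linarith
      next
        case no: False
        have "(\<Sum>s\<in>?E. \<phi> (s # t)) = \<phi> (hd t # t) + \<phi> ((x, b) # t) + \<phi> ((x, \<not> b) # t)"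
          using sum_extensions[OF t, of "\<lambda>s. \<phi> (s # t)" b] no by simp
        moreover have "\<phi> ((x, d) # t) = \<Lambda> * (9 / 8)" for d by (rule loop) (use k in simp_all)
        ultimately have sum: "(\<Sum>s\<in>?E. \<phi> (s # t)) = \<phi> (hd t # t) + \<Lambda> * (9 / 4)" by simp
        have "fst (hd t) = y" using no t letters X_eq by (cases t) auto
        then consider "hd t = (y, b)" | "hd t = (y, \<not> b)" by (cases "hd t"; cases b) auto
        then show ?thesis
        proof cases
          case 1
          then have "\<phi> t = \<Lambda>" using k b neq by (simp add: \<phi>t c_def)
          then show ?thesis using sum away 1 by simp
        next
          case 2
          then have "\<phi> t = \<Lambda> * (5 / 4)" using k b neq by (simp add: \<phi>t c_def)
          then show ?thesis using sum toward 2 by simp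
        qed
      qed
    qed
    then show ?thesis unfolding ch by (simp add: sum_subtractf card card_X(1))
  qed
  have "0 < (\<Sum>s\<in>children X x L []. 1 - \<phi> [s])"
  proof (rule sum_pos2)
    show "finite (children X x L [])" using card_X(2) by (rule finite_children)
    show "(y, True) \<in> children X x L []" using neq X_eq by (simp add: children_def reduced_Cons)
  qed (use from_root[of "[]"] neq in \<open>auto simp: \<rho>_def\<close>)
  then show ?thesis
    using sub nonneg card_X by (intro maximal_growth[where \<psi> = "\<lambda>t. 1 - \<phi> t"]) auto
qed

end

section \<open>Decay of order one over the square root\<close>

text \<open>
  Think of \<open>a n\<close> as the probability of surviving \<open>n\<close> steps and of \<open>G \<delta> n\<close> as the expectation of
  \<open>1 - (1 - \<delta>)\<^sup>h\<close> over the survivors, so that \<open>a n - G \<delta> n\<close> is the expectation of \<open>(1 - \<delta>)\<^sup>h\<close>. In each step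
  \<open>G\<close> drops by about \<open>\<delta>\<^sup>2 (a n - G \<delta> n)\<close>, starting from about \<open>\<delta>\<close>. Because \<open>G\<close> stays nonnegative, the
  sum of \<open>a\<close> over the first \<open>N\<close> steps is at most \<open>6 / \<delta> + 6 N \<delta>\<close>, which is of order \<open>\<surd>N\<close> for \<open>\<delta>\<close> of order
  \<open>1 / \<surd>N\<close>; the upper bound follows as \<open>a\<close> decreases. With this bound on the sum, \<open>G \<delta> N\<close> is still at least
  \<open>\<delta> / 2\<close> when \<open>\<delta>\<close> is a sufficiently small multiple of \<open>1 / \<surd>N\<close>, which bounds \<open>a N\<close> from below.
\<close>

lemma inverse_sqrt_bounds:
  fixes a :: "nat \<Rightarrow> real" and G :: "real \<Rightarrow> nat \<Rightarrow> real"
  assumes dec: "\<And>n. a (Suc n) \<le> a n"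
    and G: "\<And>\<delta> n. 0 < \<delta> \<Longrightarrow> \<delta> \<le> 1 / 2 \<Longrightarrow> 0 \<le> G \<delta> n \<and> G \<delta> n \<le> a n"
    and G0: "\<And>\<delta>. 0 < \<delta> \<Longrightarrow> \<delta> \<le> 1 / 2 \<Longrightarrow> \<delta> \<le> G \<delta> 0 \<and> G \<delta> 0 \<le> 6 * \<delta>"
    and up: "\<And>\<delta> n. 0 < \<delta> \<Longrightarrow> \<delta> \<le> 1 / 2 \<Longrightarrow> G \<delta> (Suc n) \<le> G \<delta> n - \<delta>\<^sup>2 * (a n - G \<delta> n)"
    and low: "\<And>\<delta> n. 0 < \<delta> \<Longrightarrow> \<delta> \<le> 1 / 2 \<Longrightarrow> G \<delta> n - 12 * \<delta>\<^sup>2 * (a n - G \<delta> n) \<le> G \<delta> (Suc n)"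
    and N: "N \<ge> 1"
  shows "a N \<le> 15 / sqrt N" and "1 / (720 * sqrt N) \<le> a N"
proof -
  define r where "r = sqrt (real N)"
  have r: "r \<ge> 1" "r\<^sup>2 = real N" using N by (simp_all add: r_def)
  have decay: "G \<delta> n \<le> 6 * \<delta> - \<delta>\<^sup>2 * (\<Sum>k<n. a k - G \<delta> k)" if "0 < \<delta>" "\<delta> \<le> 1 / 2" for \<delta> n
  proof (induction n)
    case 0
    then show ?case using G0[OF that] by simp
  next
    case (Suc n)
    then show ?case using up[OF that, of n] by (simp add: algebra_simps)
  qed
  have total: "(\<Sum>k<N. a k) \<le> 15 * r"
  proof -
    \<comment> \<open>The factor \<open>2\<close> keeps \<open>\<delta> \<le> 1 / 2\<close> when \<open>N = 1\<close>.\<close>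
    define \<delta> where "\<delta> = 1 / (2 * r)"
    have \<delta>: "0 < \<delta>" "\<delta> \<le> 1 / 2" using r by (simp_all add: \<delta>_def field_simps)
    have "\<delta>\<^sup>2 * (\<Sum>k<n. a k - G \<delta> k) \<le> 6 * \<delta>" for n
      using decay[OF \<delta>, of n] G[OF \<delta>, of n] by linarith
    then have "(\<Sum>k<N. a k - G \<delta> k) \<le> 6 / \<delta>"
      using \<delta> by (simp add: field_simps power2_eq_square)
    moreover have "G \<delta> k \<le> 6 * \<delta>" for k
    proof -
      have "0 \<le> (\<Sum>i<k. a i - G \<delta> i)" using G[OF \<delta>] by (intro sum_nonneg) simp
      then have "0 \<le> \<delta>\<^sup>2 * (\<Sum>i<k. a i - G \<delta> i)" by simp
      then show ?thesis using decay[OF \<delta>, of k] by linarith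
    qed
    then have "(\<Sum>k<N. G \<delta> k) \<le> (\<Sum>k<N. 6 * \<delta>)" by (intro sum_mono)
    ultimately have "(\<Sum>k<N. a k) \<le> 6 / \<delta> + N * (6 * \<delta>)" by (simp add: sum_subtractf)
    also have "\<dots> = 15 * r" using r(1) unfolding r(2)[symmetric] by (simp add: \<delta>_def field_simps power2_eq_square)
    finally show ?thesis .
  qed
  have "a N \<le> a k" if "k \<le> N" for k
    using lift_Suc_antimono_le[of a k N] dec that by auto
  then have "(\<Sum>k<N. a N) \<le> (\<Sum>k<N. a k)" by (intro sum_mono) simp
  then have "real N * a N \<le> 15 * r" using total by simp
  then have "r * (r * a N) \<le> r * 15" unfolding r(2)[symmetric] by (simp add: power2_eq_square mult_ac)
  then have "r * a N \<le> 15" by (rule mult_left_le_imp_le) (use r(1) in simp)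
  then show "a N \<le> 15 / sqrt N" using r(1) by (simp add: r_def[symmetric] field_simps)
  \<comment> \<open>The loss \<open>12 \<delta>\<^sup>2 (15 r) = 180 r \<delta>\<^sup>2\<close> is half of \<open>\<delta>\<close> for this choice.\<close>
  define \<delta> where "\<delta> = 1 / (360 * r)"
  have \<delta>: "0 < \<delta>" "\<delta> \<le> 1 / 2" using r by (simp_all add: \<delta>_def field_simps)
  have "\<delta> - 12 * \<delta>\<^sup>2 * (\<Sum>k<n. a k) \<le> G \<delta> n" for n
  proof (induction n)
    case 0
    then show ?case using G0[OF \<delta>] by simp
  next
    case (Suc n)
    have "0 \<le> 12 * \<delta>\<^sup>2 * G \<delta> n" using G[OF \<delta>, of n] by simp
    then show ?case using Suc low[OF \<delta>, of n] by (simp add: algebra_simps)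
  qed
  then have "\<delta> - 12 * \<delta>\<^sup>2 * (\<Sum>k<N. a k) \<le> a N" using G[OF \<delta>, of N] order.trans by blast
  moreover have "12 * \<delta>\<^sup>2 * (\<Sum>k<N. a k) \<le> 12 * \<delta>\<^sup>2 * (15 * r)"
    using total by (intro mult_left_mono) auto
  moreover have "\<delta> - 12 * \<delta>\<^sup>2 * (15 * r) = 1 / (720 * r)"
    using r(1) by (simp add: \<delta>_def field_simps power2_eq_square)
  ultimately show "1 / (720 * sqrt N) \<le> a N" unfolding r_def by linarith
qed

text \<open>The levels grow geometrically, so the ball is of the order of its last level.\<close>

lemma sum_pow3_over_sqrt_bigtheta:
  fixes A :: "nat \<Rightarrow> real"
  assumes nonneg: "\<And>n. 0 \<le> A n" and A0: "A 0 \<le> c"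
    and up: "\<And>n. n \<ge> 1 \<Longrightarrow> A n \<le> c * (3 ^ n / sqrt n)"
    and low: "\<And>n. n \<ge> 2 \<Longrightarrow> d * (3 ^ n / sqrt n) \<le> A n" and d: "d > 0"
  shows "(\<lambda>n. \<Sum>j\<le>n. A j) \<in> \<Theta>(\<lambda>n. 3 ^ n / sqrt (real n))"
proof (rule bigthetaI)
  have c: "0 \<le> c" using nonneg[of 0] A0 by simp
  have "(\<Sum>j\<le>n. A j) \<le> 2 * c * (3 ^ n / sqrt n)" if "n \<ge> 1" for n
    using that
  proof (induction n rule: dec_induct)
    case base
    then show ?case using A0 up[of 1] c by simp
  next
    case (step n)
    have "sqrt (real (Suc n)) \<le> sqrt ((3 / 2)\<^sup>2 * real n)"
      using step by (intro real_sqrt_le_mono) (auto simp: power2_eq_square)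
    also have "\<dots> = 3 / 2 * sqrt n" by (simp add: real_sqrt_mult)
    finally have "1 / sqrt n \<le> 3 / 2 * (1 / sqrt (Suc n))"
      using step by (simp add: field_simps)
    then have "2 * c * 3 ^ n * (1 / sqrt n) \<le> 2 * c * 3 ^ n * (3 / 2 * (1 / sqrt (Suc n)))"
      using c by (intro mult_left_mono) auto
    then have "2 * c * (3 ^ n / sqrt n) \<le> c * (3 ^ Suc n / sqrt (Suc n))" by (simp add: mult_ac)
    moreover have "(\<Sum>j\<le>Suc n. A j) \<le> 2 * c * (3 ^ n / sqrt n) + c * (3 ^ Suc n / sqrt (Suc n))"
      using step up[of "Suc n"] by simp
    ultimately show ?case by linarith
  qed
  then show "(\<lambda>n. \<Sum>j\<le>n. A j) \<in> O(\<lambda>n. 3 ^ n / sqrt (real n))"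
    using nonneg by (intro bigoI[of _ "2 * c"] eventually_mono[OF eventually_ge_at_top[of 1]])
      (simp add: sum_nonneg)
  have "3 ^ n / sqrt (real n) \<le> 1 / d * (\<Sum>j\<le>n. A j)" if "n \<ge> 2" for n
  proof -
    have "d * (3 ^ n / sqrt n) \<le> (\<Sum>j\<le>n. A j)"
      using low[OF that] member_le_sum[of n "{..n}" A] nonneg by force
    then show ?thesis using d by (simp add: field_simps)
  qed
  then show "(\<lambda>n. \<Sum>j\<le>n. A j) \<in> \<Omega>(\<lambda>n. 3 ^ n / sqrt (real n))"
    unfolding bigomega_iff_bigo
    using nonneg by (intro bigoI[of _ "1 / d"] eventually_mono[OF eventually_ge_at_top[of 2]])
      (simp add: sum_nonneg)
qed

section \<open>A nearly harmonic function for the second closure in rank two\<close>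

context rank_two begin

text \<open>
  Twice the harmonic function \<open>h\<close> of the walk on the line with loops that is killed when it uses a loop
  at height \<open>0\<close>. The formula is meant for surviving words; at death \<open>h\<close> takes the value \<open>0\<close>. At height \<open>k\<close>, \<open>h\<close> is \<open>\<bar>k\<bar> + 3/2\<close> after a letter \<open>x\<close>, and
  \<open>\<bar>k\<bar> + 2\<close> or \<open>\<bar>k\<bar> + 1\<close> after a move away from or towards height \<open>0\<close>. Reaching height \<open>0\<close> counts as a
  move towards it.
\<close>

definition excess :: "'a letter list \<Rightarrow> nat" where
  "excess t = (let k = height x t in
     if fst (hd t) = x then 2 * nat \<bar>k\<bar> + 3
     else if k = 0 then 2
     else if (0 < k) = snd (hd t) then 2 * nat \<bar>k\<bar> + 4 else 2 * nat \<bar>k\<bar> + 2)"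

text \<open>
  From a word to its three reduced continuations, the excess changes by \<open>0, 3, -3\<close> after a letter \<open>x\<close>,
  by \<open>2, -1, -1\<close> after a move away from height \<open>0\<close>, by \<open>-2, 1, 1\<close> after a move towards it, and by
  \<open>4, -2, -2\<close> at height \<open>0\<close> itself, where the last two continuations are dead. The changes add up to \<open>0\<close>,
  so the mean of \<open>q\<close> to the power of the excess is multiplied by \<open>1\<close> plus a term of order
  \<open>(1 - q)\<^sup>2\<close>. Dead words are given excess \<open>0\<close> and contribute \<open>1 - q\<^sup>0 = 0\<close>, so that summing over the
  children, the continuations that survive, loses nothing.
\<close>

lemma children_sum_excess:
  fixes q :: real
  assumes t: "tree_word X x H t" "t \<noteq> []" and q: "1 / 2 \<le> q" "q \<le> 1"
  defines "\<phi> \<equiv> \<lambda>t. q ^ excess t"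
  shows "3 * (1 - (1 + 12 * (1 - q)\<^sup>2) * \<phi> t) \<le> (\<Sum>s\<in>children X x H t. 1 - \<phi> (s # t))" (is ?lower)
    and "(\<Sum>s\<in>children X x H t. 1 - \<phi> (s # t)) \<le> 3 * (1 - (1 + (1 - q)\<^sup>2) * \<phi> t)" (is ?upper)
proof -
  \<comment> \<open>Used with \<open>p a\<close> for the value at \<open>t\<close> and \<open>p b\<close> for the sum over all three continuations, dead ones included.\<close>
  have bounds: "3 * (1 - (1 + 12 * (1 - q)\<^sup>2) * (p * a)) \<le> 3 - p * b \<and>
      3 - p * b \<le> 3 * (1 - (1 + (1 - q)\<^sup>2) * (p * a))"
    if "b = 3 * a + (1 - q)\<^sup>2 * r" "3 * a \<le> r" "r \<le> 36 * a" "p \<ge> 0" for p a b r :: real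
  proof -
    have "3 * (p * (1 - q)\<^sup>2 * a) \<le> p * (1 - q)\<^sup>2 * r"
      using mult_left_mono[OF that(2), of "p * (1 - q)\<^sup>2"] that(4) by simp
    moreover have "p * (1 - q)\<^sup>2 * r \<le> 36 * (p * (1 - q)\<^sup>2 * a)"
      using mult_left_mono[OF that(3), of "p * (1 - q)\<^sup>2"] that(4) by simp
    ultimately show ?thesis unfolding that(1) by (simp add: algebra_simps)
  qed
  have q0: "0 < q" "0 \<le> 1 - q" using q by auto
  have q2: "q\<^sup>2 \<le> q" "q \<le> 2 * q\<^sup>2" "q ^ 2 \<le> 2 * q ^ 3"
    using q q0 by (simp_all add: power2_eq_square power3_eq_cube mult_le_cancel_left1)
  have letters: "reduced t" "fst ` set t \<subseteq> X" using tree_word_letters[OF t(1)] by auto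
  then have carrier: "rev t \<in> carrier F" by (simp add: free_group_def)
  define k where "k = height x t"
  have "?lower \<and> ?upper"
  proof (cases "k = 0")
    case True
    obtain b where b: "hd t = (y, b)"
      using hd_tree_word_height_0[OF t] True by (metis prod.collapse k_def)
    have "children X x H t = {s \<in> extensions X t. fst s \<noteq> x}"
      using t in_H_iff_height[OF carrier] True by (auto simp: children_def extensions_def k_def)
    also have "extensions X t = X \<times> UNIV - {(y, \<not> b)}"
      using extensions_eq[OF letters(1) t(2), of X] b by (simp add: inv_letter_def)
    also have "{s \<in> X \<times> UNIV - {(y, \<not> b)}. fst s \<noteq> x} = {(y, b)}"
      unfolding X_eq using neq by (cases b) auto
    finally have "(\<Sum>s\<in>children X x H t. 1 - \<phi> (s # t)) = 1 - q ^ 6"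
      using True neq by (simp add: \<phi>_def excess_def k_def[symmetric])
    moreover have "\<phi> t = q\<^sup>2"
      using True neq b by (simp add: \<phi>_def excess_def k_def[symmetric])
    moreover have "3 * q\<^sup>2 \<le> (1 + q)\<^sup>2 * (q\<^sup>2 + 2)"
    proof -
      have "1 * (q\<^sup>2 + 2) \<le> (1 + q)\<^sup>2 * (q\<^sup>2 + 2)"
        using q0 by (intro mult_right_mono) (auto simp: power2_eq_square algebra_simps)
      moreover have "q\<^sup>2 \<le> 1" using q q0 by (simp add: power_le_one)
      ultimately show ?thesis by simp
    qed
    moreover have "(1 + q)\<^sup>2 * (q\<^sup>2 + 2) \<le> 36 * q\<^sup>2"
    proof -
      have "(1 + q)\<^sup>2 \<le> (3 * q)\<^sup>2" using q by (intro power_mono) auto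
      moreover have "q\<^sup>2 + 2 \<le> 3" using q q0 by (simp add: power_le_one)
      ultimately have "(1 + q)\<^sup>2 * (q\<^sup>2 + 2) \<le> (3 * q)\<^sup>2 * 3" by (intro mult_mono) auto
      also have "\<dots> \<le> 36 * q\<^sup>2" by (simp add: power_mult_distrib)
      finally show ?thesis .
    qed
    moreover have "2 + q ^ 6 = 3 * q\<^sup>2 + (1 - q)\<^sup>2 * ((1 + q)\<^sup>2 * (q\<^sup>2 + 2))"
      by (simp add: power2_eq_square power_numeral_reduce algebra_simps)
    ultimately show ?thesis using bounds[of "2 + q ^ 6" "q\<^sup>2" "(1 + q)\<^sup>2 * (q\<^sup>2 + 2)" 1] by simp
  next
    case False
    define b where "b \<longleftrightarrow> 0 < k"
    obtain j where j: "\<bar>k\<bar> = int (Suc j)"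
      using False by (metis abs_ge_zero nonneg_int_cases not0_implies_Suc abs_eq_0 of_nat_0)
    have e: "excess ((x, d) # t) = 2 * j + 5" "excess ((y, b) # t) = 2 * j + 8"
      "excess ((y, \<not> b) # t) = 2 * j + 2" for d
      using j neq by (auto simp: excess_def Let_def k_def[symmetric] b_def abs_if nat_eq_iff split: if_splits)
    have ch: "children X x H t = extensions X t"
      using children_eq_extensions[OF t(1)] in_H_iff_height[OF carrier] False by (simp add: k_def)
    have hd: "fst (hd t) = x \<or> hd t = (y, b) \<or> hd t = (y, \<not> b)"
      using t letters X_eq by (cases t) (auto simp: prod_eq_iff)
    let ?S = "\<Sum>s\<in>children X x H t. 1 - \<phi> (s # t)"
    from hd consider (x) "fst (hd t) = x" | (away) "hd t = (y, b)" | (toward) "hd t = (y, \<not> b)" by blast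
    then show ?thesis
    proof cases
      case x
      then obtain d where d: "hd t = (x, d)" by (metis prod.collapse)
      have S: "?S = 3 - q ^ (2 * j + 2) * (1 + q ^ 3 + q ^ 6)"
        using sum_extensions[OF t, of "\<lambda>s. 1 - \<phi> (s # t)" b] x
        by (simp add: ch \<phi>_def e d power_add algebra_simps power_numeral_reduce)
      have "excess t = 2 * j + 2 + 3"
        using x j by (simp add: excess_def Let_def k_def[symmetric])
      then have \<phi>t: "\<phi> t = q ^ (2 * j + 2) * q ^ 3" by (simp only: \<phi>_def power_add)
      have "3 * q ^ 3 \<le> (1 + q + q\<^sup>2)\<^sup>2"
      proof -
        have "q ^ 3 \<le> q\<^sup>2" using q q0 by (simp add: power2_eq_square power3_eq_cube mult_le_one)
        moreover have "(1 + q + q\<^sup>2)\<^sup>2 = 1 + 2 * q + 3 * q\<^sup>2 + 2 * q ^ 3 + q ^ 4"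
          by (simp add: power2_eq_square power_numeral_reduce algebra_simps)
        moreover have "0 \<le> q ^ 3" "0 \<le> q ^ 4" using q0 by simp_all
        ultimately show ?thesis using q0 by linarith
      qed
      moreover have "(1 + q + q\<^sup>2)\<^sup>2 \<le> 36 * q ^ 3"
      proof -
        have "(1 + q + q\<^sup>2)\<^sup>2 \<le> (4 * q)\<^sup>2" using q q2(1) q0 by (intro power_mono) auto
        moreover have "(4 * q)\<^sup>2 = 16 * q\<^sup>2" "0 \<le> q ^ 3" using q0 by (simp_all add: power_mult_distrib)
        ultimately show ?thesis using q2(3) by linarith
      qed
      moreover have "1 + q ^ 3 + q ^ 6 = 3 * q ^ 3 + (1 - q)\<^sup>2 * (1 + q + q\<^sup>2)\<^sup>2"
        by (simp add: power2_eq_square power_numeral_reduce algebra_simps)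
      ultimately show ?thesis unfolding S \<phi>t by (intro bounds) (use q0 in auto)
    next
      case away
      have S: "?S = 3 - q ^ (2 * j + 5) * (2 + q ^ 3)"
        using sum_extensions[OF t, of "\<lambda>s. 1 - \<phi> (s # t)" b] away neq
        by (simp add: ch \<phi>_def e power_add algebra_simps power_numeral_reduce)
      have "excess t = 2 * j + 5 + 1"
        using away j neq False by (simp add: excess_def Let_def k_def[symmetric] b_def)
      then have \<phi>t: "\<phi> t = q ^ (2 * j + 5) * q" by (simp only: \<phi>_def power_add power_one_right)
      have "2 + q ^ 3 = 3 * q + (1 - q)\<^sup>2 * (q + 2)"
        by (simp add: power2_eq_square power_numeral_reduce algebra_simps)
      then show ?thesis unfolding S \<phi>t by (rule bounds) (use q q0 in auto)
    next
      case toward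
      have S: "?S = 3 - q ^ (2 * j + 2) * (1 + 2 * q ^ 3)"
        using sum_extensions[OF t, of "\<lambda>s. 1 - \<phi> (s # t)" b] toward neq
        by (simp add: ch \<phi>_def e power_add algebra_simps power_numeral_reduce)
      have "excess t = 2 * j + 2 + 2"
        using toward j neq False by (simp add: excess_def Let_def k_def[symmetric] b_def)
      then have \<phi>t: "\<phi> t = q ^ (2 * j + 2) * q\<^sup>2" by (simp only: \<phi>_def power_add)
      have "1 + 2 * q ^ 3 = 3 * q\<^sup>2 + (1 - q)\<^sup>2 * (1 + 2 * q)"
        by (simp add: power2_eq_square power_numeral_reduce algebra_simps)
      moreover have "3 * q\<^sup>2 \<le> 1 + 2 * q" "1 + 2 * q \<le> 36 * q\<^sup>2" using q q2 by linarith+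
      ultimately show ?thesis unfolding S \<phi>t by (rule bounds) (use q0 in simp)
    qed
  qed
  then show ?lower ?upper by auto
qed

lemma sqrt_growth:
  "(\<lambda>n. real (card {t. tree_word X x H t \<and> length t \<le> n})) \<in> \<Theta>(\<lambda>n. 3 ^ n / sqrt (real n))"
proof -
  \<comment> \<open>The level is shifted by one because the empty word has four continuations instead of three.\<close>
  define W where "W n = tree_level X x H (Suc n)" for n
  define a where "a n = real (card (W n)) / (2 * 3 ^ n)" for n
  define g where "g \<delta> t = 1 - (1 - \<delta> :: real) ^ excess t" for \<delta> t
  define G where "G \<delta> n = (\<Sum>t\<in>W n. g \<delta> t) / (2 * 3 ^ n)" for \<delta> n
  have W: "tree_word X x H t" "t \<noteq> []" if "t \<in> W n" for t n
    using that by (auto simp: W_def tree_level_def)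
  have dec: "a (Suc n) \<le> a n" for n
  proof -
    have "card (W (Suc n)) \<le> 3 * card (W n)"
      using card_tree_level_Suc_le[OF card_X(2), of "Suc n" x H] by (simp add: W_def card_X(1))
    then have "real (card (W (Suc n))) \<le> 3 * real (card (W n))" by linarith
    then show ?thesis by (simp add: a_def field_simps)
  qed
  have G: "0 \<le> G \<delta> n \<and> G \<delta> n \<le> a n" if "0 < \<delta>" "\<delta> \<le> 1 / 2" for \<delta> n
  proof -
    have "0 \<le> g \<delta> t" "g \<delta> t \<le> 1" for t using that by (auto simp: g_def power_le_one)
    then have "0 \<le> sum (g \<delta>) (W n)" "sum (g \<delta>) (W n) \<le> real (card (W n))"
      using sum_mono[of "W n" "g \<delta>" "\<lambda>_. 1"] by (simp_all add: sum_nonneg)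
    then show ?thesis by (simp add: G_def a_def divide_right_mono)
  qed
  have G0: "\<delta> \<le> G \<delta> 0 \<and> G \<delta> 0 \<le> 6 * \<delta>" if \<delta>: "0 < \<delta>" "\<delta> \<le> 1 / 2" for \<delta>
  proof -
    have L: "[] \<in> H" using subgroup.one_closed[OF H_subgroup] by (simp add: free_group_def)
    then have "children X x H [] = {(y, True), (y, False)}"
      using neq by (auto simp: children_def X_eq reduced_Cons)
    then have "G \<delta> 0 = 1 - (1 - \<delta>) ^ 6"
      using neq by (simp add: G_def W_def sum_tree_level_Suc[OF card_X(2)] g_def excess_def)
    moreover have "(1 - \<delta>) ^ 6 \<le> 1 - \<delta>" using \<delta> power_decreasing[of 1 6 "1 - \<delta>"] by simp
    moreover have "1 - 6 * \<delta> \<le> (1 - \<delta>) ^ 6" using \<delta> Bernoulli_inequality[of "- \<delta>" 6] by simp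
    ultimately show ?thesis by simp
  qed
  have G_Suc: "G \<delta> (Suc n) = (\<Sum>t\<in>W n. \<Sum>s\<in>children X x H t. g \<delta> (s # t)) / (2 * 3 ^ Suc n)" for \<delta> n
    unfolding G_def W_def by (simp only: sum_tree_level_Suc[OF card_X(2), of _ _ _ "Suc n"])
  have avg: "(\<Sum>t\<in>W n. 3 * (1 - (1 + c) * (1 - \<delta>) ^ excess t)) / (2 * 3 ^ Suc n)
      = G \<delta> n - c * (a n - G \<delta> n)" for c \<delta> n
  proof -
    define S where "S = (\<Sum>t\<in>W n. (1 - \<delta>) ^ excess t)"
    have sum: "(\<Sum>t\<in>W n. 3 * (1 - (1 + c) * (1 - \<delta>) ^ excess t)) = 3 * (real (card (W n)) - (1 + c) * S)"
      by (simp add: S_def sum_distrib_left[symmetric] sum_subtractf)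
    have G_n: "G \<delta> n = (real (card (W n)) - S) / (2 * 3 ^ n)"
      by (simp add: G_def g_def sum_subtractf S_def)
    show ?thesis unfolding sum G_n a_def by (simp add: field_simps)
  qed
  have up: "G \<delta> (Suc n) \<le> G \<delta> n - \<delta>\<^sup>2 * (a n - G \<delta> n)"
    and low: "G \<delta> n - 12 * \<delta>\<^sup>2 * (a n - G \<delta> n) \<le> G \<delta> (Suc n)"
    if \<delta>: "0 < \<delta>" "\<delta> \<le> 1 / 2" for \<delta> n
    unfolding avg[symmetric] G_Suc g_def
    using children_sum_excess[of _ "1 - \<delta>"] W \<delta> by (auto intro!: divide_right_mono sum_mono)
  note bounds = inverse_sqrt_bounds[of a G, OF dec G G0 up low]
  define A where "A n = real (card (tree_level X x H n))" for n
  have A_Suc: "A (Suc k) = 2 * 3 ^ k * a k" for k by (simp add: A_def a_def W_def)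
  have upper: "A n \<le> 20 * (3 ^ n / sqrt n)" if n: "n \<ge> 1" for n
  proof -
    obtain k where k: "n = Suc k" using n by (cases n) auto
    show ?thesis
    proof (cases "k = 0")
      case True
      have "A 1 \<le> real (2 * (2 * card X - 1) ^ 1)"
        unfolding A_def using card_X by (intro of_nat_mono card_tree_level_le) auto
      then show ?thesis using True by (simp add: k card_X(1))
    next
      case False
      have "sqrt (real n) \<le> sqrt (2\<^sup>2 * real k)"
        using False k by (intro real_sqrt_le_mono) simp
      also have "\<dots> = 2 * sqrt k" by (simp add: real_sqrt_mult)
      finally have "15 / sqrt k \<le> 30 / sqrt n" using False k by (simp add: field_simps)
      then have "a k \<le> 30 / sqrt n" using bounds(1)[of k] False by simp
      then have "2 * 3 ^ k * a k \<le> 2 * 3 ^ k * (30 / sqrt n)" by (intro mult_left_mono) auto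
      then show ?thesis by (simp add: A_Suc k)
    qed
  qed
  have lower: "1 / 1080 * (3 ^ n / sqrt n) \<le> A n" if n: "n \<ge> 2" for n
  proof -
    obtain k where k: "n = Suc k" "k \<ge> 1" using n by (cases n) auto
    have "1 / (720 * sqrt n) \<le> 1 / (720 * sqrt k)"
      using k by (intro divide_left_mono) auto
    then have "1 / (720 * sqrt n) \<le> a k" using bounds(2)[of k] k(2) by linarith
    then have "2 * 3 ^ k * (1 / (720 * sqrt n)) \<le> 2 * 3 ^ k * a k" by (intro mult_left_mono) auto
    then show ?thesis unfolding k(1) A_Suc by (simp add: field_simps)
  qed
  have "(\<lambda>n. \<Sum>j\<le>n. A j) \<in> \<Theta>(\<lambda>n. 3 ^ n / sqrt (real n))"
    by (rule sum_pow3_over_sqrt_bigtheta[where c = 20 and d = "1 / 1080"])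
      (use upper lower in \<open>auto simp: A_def\<close>)
  then show ?thesis by (simp add: card_tree_ball[OF card_X(2)] A_def)
qed

end

section \<open>Cogrowth of subnormal closures\<close>

lemma closure_in_subgroup_subnormal_closure:
  assumes "x \<in> X"
  shows "closure_in_subgroup X x (subnormal_closure (free_group X) l (free_gen x))
    (subnormal_closure (free_group X) (Suc l) (free_gen x))"
proof (induction l)
  case 0
  show ?case
    using assms group.subgroup_self[OF group_free_group, of X]
    by (intro closure_in_subgroup.intro subgroup_with_generator.intro closure_in_subgroup_axioms.intro)
      (simp_all add: free_gen_closed)
next
  case (Suc l)
  then interpret closure_in_subgroup X x "subnormal_closure (free_group X) l (free_gen x)"
    "subnormal_closure (free_group X) (Suc l) (free_gen x)" .
  show ?case
    by (intro closure_in_subgroup.intro subgroup_with_generator.intro closure_in_subgroup_axioms.intro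
        x_in H_subgroup gen_in_H) simp
qed

lemma subnormal_closure_antimono:
  assumes "x \<in> X" and "k \<le> l"
  shows "subnormal_closure (free_group X) l (free_gen x) \<subseteq> subnormal_closure (free_group X) k (free_gen x)"
  using closure_in_subgroup.H_subset_L[OF closure_in_subgroup_subnormal_closure[OF assms(1)]] assms(2)
  by (rule lift_Suc_antimono_le)

theorem theorem1p9:
  fixes X :: "'a set" and x :: 'a and m l :: nat
  assumes "finite X" and "card X = m" and "x \<in> X" and "l \<ge> 1"
  shows "let F = free_group X;
             H = subnormal_closure F l (free_gen x);
             f = (\<lambda>n. real (cogrowth F (free_gen ` X) H n))
         in (l \<ge> 2 \<and> m \<ge> 3 \<longrightarrow> f \<in> \<Theta>(\<lambda>n. (2 * real m - 1) ^ n))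
          \<and> (l \<ge> 3 \<and> m \<ge> 2 \<longrightarrow> f \<in> \<Theta>(\<lambda>n. (2 * real m - 1) ^ n))
          \<and> (l = 2 \<and> m = 2 \<longrightarrow> f \<in> \<Theta>(\<lambda>n. 3 ^ n / sqrt (real n)))"
proof -
  let ?F = "free_group X"
  define N where "N k = subnormal_closure ?F k (free_gen x)" for k
  note closure = closure_in_subgroup_subnormal_closure[OF assms(3), folded N_def]
  note antimono = subnormal_closure_antimono[OF assms(3), folded N_def]
  have N0: "N 0 = carrier ?F" by (simp add: N_def)
  obtain k where k: "l = Suc k" using assms(4) by (cases l) auto
  define f where "f n = real (card {t. tree_word X x (N k) t \<and> length t \<le> n})" for n
  have cogrowth: "real (cogrowth ?F (free_gen ` X) (N l) n) = f n" for n
    using closure_in_subgroup.cogrowth_eq_card_tree_words[OF closure[of k]] by (simp add: k f_def)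
  have rank_two: "\<exists>y. rank_two X x (N 1) y" if m: "m = 2"
  proof -
    have "card (X - {x}) = 1" using assms m by simp
    then obtain y where "X - {x} = {y}" by (meson card_1_singletonE)
    then have "X = {x, y}" "x \<noteq> y" using assms(3) by auto
    then show ?thesis
      using closure[of 0] by (auto simp: N0 rank_two_def rank_two_axioms_def)
  qed
  have high_rank: "f \<in> \<Theta>(\<lambda>n. (2 * real m - 1) ^ n)" if "l \<ge> 2" "m \<ge> 3"
    unfolding f_def assms(2)[symmetric]
    by (rule maximal_growth_rank_ge_3[of X x "N 1"])
      (use closure[of 0] assms that antimono[of 1 k] k in \<open>auto simp: N0\<close>)
  have maximal: "f \<in> \<Theta>(\<lambda>n. (2 * real m - 1) ^ n)" if lm: "l \<ge> 3" "m \<ge> 2"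
  proof (cases "m = 2")
    case True
    then obtain y where y: "rank_two X x (N 1) y" using rank_two by blast
    show ?thesis
      unfolding f_def assms(2)[symmetric]
      by (rule rank_two.maximal_growth_rank_two[OF y, of "N 2"])
        (use closure[of 1] antimono[of 2 k] k lm in \<open>auto simp: numeral_2_eq_2\<close>)
  qed (use high_rank lm in auto)
  have sqrt: "f \<in> \<Theta>(\<lambda>n. 3 ^ n / sqrt (real n))" if "l = 2" "m = 2"
  proof -
    obtain y where y: "rank_two X x (N 1) y" using rank_two \<open>m = 2\<close> by blast
    have "k = 1" using \<open>l = 2\<close> k by simp
    then show ?thesis using rank_two.sqrt_growth[OF y] by (simp add: f_def[abs_def])
  qed
  have f: "(\<lambda>n. real (cogrowth ?F (free_gen ` X) (subnormal_closure ?F l (free_gen x)) n)) = f"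
    using cogrowth by (auto simp: N_def)
  show ?thesis unfolding Let_def f using high_rank maximal sqrt by blast
qed

end
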